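(* For integers $n\ge 1$ and $d\ge 1$, let $k$ be the least integer such that \[ n \le k + (d+1)\cdot \sum_{j=0}^{d-1} (d-j)\binom{k+j-1}{j}. \] Let $q$ be a prime power, let $f\colon \mathbb{F}_q^n\to\mathbb{F}_q$ be a polynomial of degree $d$, and let $u_0\in\mathbb{F}_q^n$. Then there exists a linear subspace $U\subseteq\mathbb{F}_q^n$ of dimension $k$ such that $f$ restricted to $u_0+U$ is constant. In particular, there exists a universal constant $c_0\in(0,1)$ such that for all $n,d,q$ it holds that $k_q(n,d)\ge c_0\cdot n^{1/(d-1)}$. Moreover, for $d\le \log(n)/10$ it holds that $k_q(n,d)=\Omega(d\cdot n^{1/(d-1)})$.
   Context: The degree of a function $f\colon\mathbb{F}_q^n\to\mathbb{F}_q$ is the total degree of the unique polynomial over $\mathbb{F}_q$ with all individual degrees at most $q-1$ that agrees with $f$ on $\mathbb{F}_q^n$. For a prime power $q$ and integers $n,d$, $k_q(n,d)$ denotes the largest integer $k$ such that every polynomial on $n$ variables over $\mathbb{F}_q$ of degree at most $d$ is constant on some affine subspace of $\mathbb{F}_q^n$ of dimension $k$. Logarithms are to base $2$. The constant in $\Omega$ is universal.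
   Formalization: Both bounds on k_q(n,d) are stated for d≥2, since 1/(d-1) is undefined at d=1; the bound k_q(n,d) ≥ c_0 n^{1/(d-1)} is stated when n>d(d+1) or k_q(n,d)≠0, since it fails when k_q(n,d)=0 (e.g. n=1, f(x)=x). *)

theory Defs
  imports
    Complex_Main
    "HOL-Algebra.AbelCoset"
    "Jordan_Normal_Form.Missing_VectorSpace"
begin

text \<open>The coordinate space $F^n$: extensional functions \<open>{..<n} \<rightarrow>\<^sub>E carrier F\<close> with pointwise
  operations.\<close>

abbreviation coord_space :: "'a ring \<Rightarrow> nat \<Rightarrow> ('a, nat \<Rightarrow> 'a) module" where
  "coord_space F n \<equiv> ring.func_space F {..<n}"

definition reduced_exponents :: "'a ring \<Rightarrow> nat \<Rightarrow> (nat \<Rightarrow> nat) set" where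
  "reduced_exponents F n = {..<n} \<rightarrow>\<^sub>E {..<card (carrier F)}"

definition poly_eval ::
    "'a ring \<Rightarrow> nat \<Rightarrow> ((nat \<Rightarrow> nat) \<Rightarrow> 'a) \<Rightarrow> (nat \<Rightarrow> 'a) \<Rightarrow> 'a" where
  "poly_eval F n c x =
     (\<Oplus>\<^bsub>F\<^esub>e\<in>reduced_exponents F n. c e \<otimes>\<^bsub>F\<^esub> (\<Otimes>\<^bsub>F\<^esub>i\<in>{..<n}. x i [^]\<^bsub>F\<^esub> (e i :: nat)))"

text \<open>For a finite field \<open>F\<close> with $q$ elements, the coefficients of the unique polynomial with all
  individual degrees at most $q - 1$ that agrees with \<open>f\<close> on $F^n$.\<close>

definition reduced_coeffs ::
    "'a ring \<Rightarrow> nat \<Rightarrow> ((nat \<Rightarrow> 'a) \<Rightarrow> 'a) \<Rightarrow> (nat \<Rightarrow> nat) \<Rightarrow> 'a" where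
  "reduced_coeffs F n f =
     (THE c. c \<in> reduced_exponents F n \<rightarrow>\<^sub>E carrier F \<and>
        (\<forall>x\<in>carrier (coord_space F n). poly_eval F n c x = f x))"

text \<open>The zero function gets degree 0, so that it is among the functions of degree at most \<open>d\<close>
  for every \<open>d\<close>.\<close>

definition fun_degree :: "'a ring \<Rightarrow> nat \<Rightarrow> ((nat \<Rightarrow> 'a) \<Rightarrow> 'a) \<Rightarrow> nat" where
  "fun_degree F n f =
     Max (insert 0 ((\<lambda>e. \<Sum>i<n. e i) `
       {e \<in> reduced_exponents F n. reduced_coeffs F n f e \<noteq> \<zero>\<^bsub>F\<^esub>}))"

definition linear_subspace_of_dim :: "'a ring \<Rightarrow> nat \<Rightarrow> nat \<Rightarrow> (nat \<Rightarrow> 'a) set \<Rightarrow> bool" where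
  "linear_subspace_of_dim F n k U \<longleftrightarrow>
     subspace F U (coord_space F n) \<and>
     vectorspace.dim F ((coord_space F n)\<lparr>carrier := U\<rparr>) = k"

definition constant_on_translate ::
    "'a ring \<Rightarrow> nat \<Rightarrow> ((nat \<Rightarrow> 'a) \<Rightarrow> 'a) \<Rightarrow> (nat \<Rightarrow> 'a) \<Rightarrow> (nat \<Rightarrow> 'a) set \<Rightarrow> bool" where
  "constant_on_translate F n f u\<^sub>0 U \<longleftrightarrow>
     (\<exists>a. \<forall>x \<in> u\<^sub>0 <+\<^bsub>coord_space F n\<^esub> U. f x = a)"

text \<open>This is $k_q(n,d)$ for a field \<open>F\<close> with $q$ elements; it depends on \<open>F\<close> only up to
  isomorphism, hence only on $q$. A bound uniform over all prime powers $q$ can therefore be stated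
  by quantifying over finite fields \<open>F :: nat ring\<close>: every finite field is isomorphic to one whose
  carrier is a set of natural numbers, and the finite fields realise exactly the prime powers. A
  maximum exists, since \<open>k = 0\<close> always qualifies and \<open>k \<le> n\<close>.\<close>

definition max_const_dim :: "'a ring \<Rightarrow> nat \<Rightarrow> nat \<Rightarrow> nat" where
  "max_const_dim F n d =
     (GREATEST k. \<forall>f \<in> carrier (coord_space F n) \<rightarrow> carrier F. fun_degree F n f \<le> d \<longrightarrow>
        (\<exists>u\<^sub>0 \<in> carrier (coord_space F n). \<exists>U.
           linear_subspace_of_dim F n k U \<and> constant_on_translate F n f u\<^sub>0 U))"

text \<open>Being a dimension, \<open>k\<close> ranges over the natural numbers. Truncated subtraction is harmless:
  it takes effect only for \<open>k = j = 0\<close>, where \<open>0 choose 0 = 1\<close> agrees with the usual value of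
  $\binom{-1}{0}$.\<close>

definition guaranteed_dim :: "nat \<Rightarrow> nat \<Rightarrow> nat" where
  "guaranteed_dim n d =
     (LEAST k. n \<le> k + (d + 1) * (\<Sum>j=0..d - 1. (d - j) * ((k + j - 1) choose j)))"

end

theory Submission
  imports Defs "HOL-Algebra.Multiplicative_Group"
begin

text \<open>The subspace is grown one dimension at a time. Suppose \<open>f\<close> is constant on \<open>u + U\<close>, where \<open>U\<close> is
  spanned by $v_0, \dots, v_{k-1}$. Expanding $f(u + \sum_j b_j v_j + a x)$ in powers of \<open>a\<close> and
  monomials in \<open>b\<close>, the coefficient of $a^i b^e$ is a polynomial in \<open>x\<close> of degree at most $d - |e|$.
  If all these coefficients take at \<open>x\<close> the value they take at 0, then \<open>f\<close> is constant on
  $u + U + \langle x \rangle$. There are $d + 1$ choices of \<open>i\<close> and $\binom{k+j-1}{j}$ exponents \<open>e\<close>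
  with $|e| = j$; together with \<open>k\<close> linear equations that have no nonzero solution in \<open>U\<close>, the
  degrees add up to $k + (d+1)\sum_j (d-j)\binom{k+j-1}{j}$. If this is less than \<open>n\<close>, the
  Chevalley--Warning theorem yields a solution $x \neq 0$, which then lies outside \<open>U\<close>.
  The asymptotic bounds follow from $\sum_j (d-j)\binom{k+j-1}{j} = \binom{k+d}{d-1}$.\<close>

section \<open>Numerical estimates and counting\<close>

text \<open>Chevalley--Warning compares only a total degree with the number of variables, which is
  why the dimension obtained does not depend on q. It must start from a common zero: subtracting
  from each coefficient its value at 0 makes 0 such a zero, and the second zero is the wanted
  vector. The power of a is kept out of the degree count, so each of its d + 1 possible exponents is
  charged the same bound d - |e|; this is the origin of the factor d + 1. Since
  \<open>x^q = x\<close> on the field, normal forms behave badly under products and substitution. A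
  degree is therefore handled as an upper bound witnessed by some representing polynomial, reduced
  or not; reduced polynomials enter only to connect \<open>fun_degree\<close> with such bounds.
  Dimensions are found by counting points: a subspace with \<open>q^k\<close> elements has dimension
  k.\<close>

text \<open>Raising \<open>m\<close> by one adds 1 to every weight, so the sum grows by an
  unweighted hockey-stick sum, and Pascal's rule closes the induction.\<close>

lemma sum_weighted_binomial:
  "(\<Sum>j=0..m. (m + 1 - j) * ((k + j - 1) choose j)) = (k + m + 1) choose m"
proof (cases k)
  \<comment> \<open>Here \<open>(j - 1) choose j\<close> vanishes for positive \<open>j\<close>,
    which leaves the term \<open>j = 0\<close>. For positive \<open>k\<close>, writing it as a
    successor removes the truncated subtraction.\<close>
  case 0
  have "(\<Sum>j=0..m. (m + 1 - j) * ((j - 1) choose j)) = (\<Sum>j\<in>{0}. (m + 1 - j) * ((j - 1) choose j))"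
    by (rule sum.mono_neutral_right) auto
  then show ?thesis using 0 by simp
next
  case (Suc k')
  have "(\<Sum>j=0..m. (m + 1 - j) * ((k' + j) choose j)) = (k' + m + 2) choose m"
  proof (induction m)
    case (Suc m)
    have "(\<Sum>j=0..Suc m. (Suc m + 1 - j) * ((k' + j) choose j))
      = (\<Sum>j=0..Suc m. ((k' + j) choose j)) + (\<Sum>j=0..Suc m. (m + 1 - j) * ((k' + j) choose j))"
      unfolding sum.distrib[symmetric] by (intro sum.cong) (auto simp: Suc_diff_le)
    also have "(\<Sum>j=0..Suc m. ((k' + j) choose j)) = (k' + m + 2) choose Suc m"
      using sum_choose_lower[of k' "Suc m"] by (simp add: atMost_atLeast0)
    also have "(\<Sum>j=0..Suc m. (m + 1 - j) * ((k' + j) choose j)) = (k' + m + 2) choose m"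
      using Suc.IH by simp
    finally show ?case by simp
  qed simp
  then show ?thesis using Suc by simp
qed

lemma guaranteed_dim_property:
  assumes "1 \<le> d"
  shows "n \<le> guaranteed_dim n d + (d + 1) * ((guaranteed_dim n d + d) choose (d - 1))"
proof -
  obtain m where m: "d = m + 1" using assms by (metis add.commute le_Suc_ex)
  have eq: "(\<Sum>j=0..d - 1. (d - j) * ((k + j - 1) choose j)) = (k + d) choose (d - 1)" for k
    using sum_weighted_binomial[of m k] m by (simp add: add.assoc)
  show ?thesis
    \<comment> \<open>The witness \<open>n\<close> satisfies the inequality by its first summand
      alone, so a least \<open>k\<close> exists.\<close>
    unfolding guaranteed_dim_def eq by (rule LeastI[of _ n]) simp
qed

text \<open>At \<open>k = 0\<close> the defining inequality reads
  \<open>n \<le> d * (d + 1)\<close>, whence the threshold.\<close>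

lemma guaranteed_dim_pos:
  assumes "d * (d + 1) < n" "1 \<le> d"
  shows "guaranteed_dim n d > 0"
proof (rule ccontr)
  assume "\<not> guaranteed_dim n d > 0"
  then have "n \<le> (d + 1) * (d choose (d - 1))"
    using guaranteed_dim_property[OF assms(2), of n] by simp
  moreover have "d choose (d - 1) = d" using binomial_Suc_n[of "d - 1"] assms by simp
  ultimately show False using assms by (simp add: mult.commute)
qed

text \<open>By minimality the defining inequality fails below \<open>guaranteed_dim n d\<close>, and
  this failure is exactly the degree count that Chevalley--Warning asks for.\<close>

lemma guaranteed_dim_less:
  assumes "k < guaranteed_dim n d"
  shows "k + (d + 1) * (\<Sum>j=0..d - 1. (d - j) * ((k + j - 1) choose j)) < n"
  using not_less_Least[OF assms[unfolded guaranteed_dim_def]] by simp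

text \<open>The binomial is the product of the factors
  \<open>(k + 1 + i) / i = 1 + (k + 1) / i\<close> for i from 1 to \<open>m\<close>, each at most
  \<open>k + 2\<close>.\<close>

lemma binomial_le_pow_shift: "(k + m + 1) choose m \<le> (k + 2) ^ m"
proof (induction m)
  case (Suc m)
  have "Suc m * ((k + Suc m + 1) choose Suc m) = (k + m + 2) * ((k + m + 1) choose m)"
    using Suc_times_binomial_eq[of "k + m + 1" m] by simp
  also have "\<dots> \<le> (Suc m * (k + 2)) * (k + 2) ^ m"
    using Suc by (intro mult_mono) auto
  also have "\<dots> = Suc m * (k + 2) ^ Suc m" by (simp only: power_Suc mult.assoc)
  finally have "Suc m * ((k + Suc m + 1) choose Suc m) \<le> Suc m * (k + 2) ^ Suc m" .
  then show ?case using mult_le_cancel1 by blast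
qed simp

text \<open>Absorbs a linear factor into an m-th power; equality at \<open>m = 1\<close> fixes the
  base 4.\<close>

lemma add_3_le_4_pow: "1 \<le> m \<Longrightarrow> m + 3 \<le> (4::nat) ^ m"
  by (induction m rule: dec_induct) auto

lemma le_pow_imp_root_le:
  assumes "1 \<le> m" "0 \<le> a" "real n \<le> a ^ m"
  shows "real n powr (1 / real m) \<le> a"
proof -
  have "real n powr (1 / real m) \<le> (a ^ m) powr (1 / real m)"
    using assms by (intro powr_mono2) auto
  also have "\<dots> = a"
  proof (cases "a = 0")
    case False
    then show ?thesis using assms by (simp add: powr_powr flip: powr_realpow)
  qed (use assms in \<open>simp add: zero_power\<close>)
  finally show ?thesis .
qed

text \<open>The crude factorwise bound on the binomial is enough here. It leaves an additive 8,
  which is harmless only once the dimension is known to be positive.\<close>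

lemma root_le_guaranteed_dim:
  assumes "2 \<le> d"
  shows "real n powr (1 / (real d - 1)) \<le> 4 * real (guaranteed_dim n d) + 8"
proof -
  define m where "m = d - 1"
  define k where "k = guaranteed_dim n d"
  have m: "1 \<le> m" "d = m + 1" using assms by (auto simp: m_def)
  have "n \<le> k + (m + 2) * ((k + m + 1) choose m)"
    using guaranteed_dim_property[of d n] m by (simp add: k_def add.assoc)
  also have "\<dots> \<le> (k + 2) ^ m + (m + 2) * (k + 2) ^ m"
    using binomial_le_pow_shift[of k m] self_le_power[of "k + 2" m] m
    by (intro add_mono mult_left_mono) auto
  also have "\<dots> = (m + 3) * (k + 2) ^ m" by (simp add: algebra_simps)
  also have "\<dots> \<le> 4 ^ m * (k + 2) ^ m" using add_3_le_4_pow[OF m(1)] by (intro mult_right_mono) auto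
  also have "\<dots> = (4 * k + 8) ^ m" by (simp add: algebra_simps flip: power_mult_distrib)
  finally have "real n \<le> real ((4 * k + 8) ^ m)" by linarith
  then have "real n powr (1 / real m) \<le> 4 * real k + 8"
    using m by (intro le_pow_imp_root_le) auto
  then show ?thesis using m by (simp add: k_def)
qed

text \<open>A single term of the exponential series at \<open>m\<close> is at most its sum
  \<open>exp m\<close>, and e is at most 3.\<close>

lemma pow_le_fact: "(real m / 3) ^ m \<le> fact m"
proof -
  have "real m ^ m / fact m \<le> (\<Sum>j. real m ^ j /\<^sub>R fact j)"
    using sum_le_suminf[OF summable_exp_generic[of "real m"], of "{m}"]
    by (simp add: field_simps)
  also have "\<dots> = exp (real m)" by (simp add: exp_def)
  also have "\<dots> = exp 1 ^ m" by (simp flip: exp_of_nat_mult)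
  also have "\<dots> \<le> 3 ^ m" using exp_le by (intro power_mono) auto
  finally show ?thesis by (simp add: power_divide field_simps)
qed

text \<open>The usual estimate \<open>(e N / m)^m\<close> for N choose m, with 3 in place of e. The
  denominator \<open>m\<close>, absent from \<open>binomial_le_pow_shift\<close>, is what yields the
  extra factor \<open>d\<close> in the second asymptotic bound.\<close>

lemma binomial_le_pow_div:
  assumes "1 \<le> m"
  shows "real ((k + m + 1) choose m) \<le> (3 * real (k + m + 1) / real m) ^ m"
proof -
  have "real ((k + m + 1) choose m) * (real m / 3) ^ m \<le> real ((k + m + 1) choose m) * fact m"
    using pow_le_fact by (intro mult_left_mono) auto
  also have "\<dots> \<le> real (k + m + 1) ^ m"
    using of_nat_mono[OF binomial_fact_pow[of "k + m + 1" m], where 'a = real] by simp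
  finally have "real ((k + m + 1) choose m) * (real m / 3) ^ m \<le> real (k + m + 1) ^ m" .
  then have "real ((k + m + 1) choose m) \<le> real (k + m + 1) ^ m / (real m / 3) ^ m"
    using assms by (subst pos_le_divide_eq) auto
  also have "\<dots> = (real (k + m + 1) / (real m / 3)) ^ m" by (rule power_divide[symmetric])
  also have "real (k + m + 1) / (real m / 3) = 3 * real (k + m + 1) / real m" by simp
  finally show ?thesis .
qed

lemma d_root_le_guaranteed_dim:
  assumes "1 \<le> n" "2 \<le> d" "real d \<le> log 2 (real n) / 10"
  shows "real d * real n powr (1 / (real d - 1)) \<le> 48 * real (guaranteed_dim n d)"
proof -
  define m where "m = d - 1"
  define k where "k = guaranteed_dim n d"
  define N where "N = real n powr (1 / real m)"
  have m: "1 \<le> m" "d = m + 1" using assms by (auto simp: m_def)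
  \<comment> \<open>The assumption on \<open>d\<close> says that n is at least
    \<open>2 ^ (10 * d)\<close>, so its m-th root \<open>N\<close> is at least
    \<open>2 ^ 10 = 1024\<close>.\<close>
  have "2 powr (10 * real m) \<le> 2 powr (log 2 (real n))" using assms m by (intro powr_mono) auto
  also have "\<dots> = real n" using assms by simp
  finally have "(2 powr (10 * real m)) powr (1 / real m) \<le> N"
    unfolding N_def by (intro powr_mono2) auto
  then have N: "1024 \<le> N" using m by (simp add: powr_powr)
  have "n \<le> k + (m + 2) * ((k + m + 1) choose m)"
    using guaranteed_dim_property[of d n] m by (simp add: k_def add.assoc)
  moreover have "k \<le> (k + m + 1) choose m"
    using m(1) by (induction m rule: dec_induct) auto
  ultimately have "n \<le> (m + 3) * ((k + m + 1) choose m)" by (simp add: algebra_simps)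
  also have "\<dots> \<le> 4 ^ m * ((k + m + 1) choose m)"
    using add_3_le_4_pow[OF m(1)] by (intro mult_right_mono) auto
  finally have "real n \<le> real (4 ^ m * ((k + m + 1) choose m))" by (rule of_nat_mono)
  also have "\<dots> = 4 ^ m * real ((k + m + 1) choose m)" by simp
  also have "\<dots> \<le> 4 ^ m * (3 * real (k + m + 1) / real m) ^ m"
    using binomial_le_pow_div[OF m(1)] by (intro mult_left_mono) auto
  also have "\<dots> = (12 * real (k + m + 1) / real m) ^ m"
    by (simp flip: power_mult_distrib)
  finally have "N \<le> 12 * real (k + m + 1) / real m"
    unfolding N_def using m by (intro le_pow_imp_root_le) auto
  then have "real m * N \<le> 12 * real k + 12 * real m + 12"
    using m by (simp add: field_simps)
  \<comment> \<open>Since \<open>12 * m + 12 \<le> 24 * m\<close> is less than half of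
    \<open>m * N\<close>, it can be absorbed on the left, which doubles 12 to 24. Passing from
    \<open>m\<close> to \<open>d = m + 1\<close> doubles once more and gives 48.\<close>
  moreover have "real m * 1024 \<le> real m * N" using N by (rule mult_left_mono) simp
  moreover have "1 \<le> real m" using m by simp
  ultimately have "real m * N \<le> 24 * real k" by linarith
  moreover have "real d * N \<le> 2 * (real m * N)"
    using m N by (simp add: algebra_simps)
  ultimately show ?thesis using m by (simp add: N_def k_def)
qed

section \<open>Counting exponent vectors and the points of a vector space\<close>

lemma finite_lists_sum_le: "finite {l :: nat list. length l = k \<and> sum_list l \<le> d}"
proof (rule finite_subset)
  show "{l :: nat list. length l = k \<and> sum_list l \<le> d} \<subseteq> {l. set l \<subseteq> {..d} \<and> length l = k}"
    using member_le_sum_list by fastforce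
qed (rule finite_lists_length_eq, simp)

text \<open>Group the exponent vectors by total degree \<open>j\<close> and count each group by
  stars and bars. The weight vanishes at \<open>j = d\<close>, so the range can stop at
  \<open>d - 1\<close>.\<close>

lemma sum_over_exponent_lists:
  assumes "1 \<le> d"
  shows "(\<Sum>l | length l = k \<and> sum_list l \<le> d. d - sum_list l)
    = (\<Sum>j=0..d - 1. (d - j) * ((k + j - 1) choose j))"
proof -
  let ?L = "{l :: nat list. length l = k \<and> sum_list l \<le> d}"
  have "(\<Sum>l\<in>?L. d - sum_list l) = (\<Sum>j\<le>d. \<Sum>l\<in>{l\<in>?L. sum_list l = j}. d - sum_list l)"
    by (rule sum.group[symmetric]) (use finite_lists_sum_le in auto)
  also have "\<dots> = (\<Sum>j\<le>d. (d - j) * ((k + j - 1) choose j))"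
  proof (rule sum.cong)
    fix j assume "j \<in> {..d}"
    then have "{l\<in>?L. sum_list l = j} = {l. length l = k \<and> sum_list l = j}" by auto
    then show "(\<Sum>l\<in>{l\<in>?L. sum_list l = j}. d - sum_list l) = (d - j) * ((k + j - 1) choose j)"
      using card_length_sum_list[of k j] by (simp add: add.commute)
  qed simp
  also have "\<dots> = (\<Sum>j=0..d - 1. (d - j) * ((k + j - 1) choose j))"
    using assms by (intro sum.mono_neutral_right) (auto simp: not_le)
  finally show ?thesis .
qed

lemma (in vectorspace) card_carrier_eq_power_dim:
  assumes "finite (carrier V)"
  shows "card (carrier V) = card (carrier K) ^ dim"
proof -
  have "gen_set (carrier V)"
    using in_own_span[of "carrier V"] span_is_subset2[of "carrier V"] by auto
  then have "fin_dim" unfolding fin_dim_def using assms by auto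
  then obtain B where B: "finite B" "basis B" using finite_basis_exists by blast
  then have BV: "B \<subseteq> carrier V" unfolding basis_def by simp
  have *: "\<exists>!a. a \<in> B \<rightarrow>\<^sub>E carrier K \<and> lincomb a B = v" if "v \<in> carrier V" for v
    using basis_criterion[OF B(1) BV] B(2) that by blast
  have "bij_betw (\<lambda>a. lincomb a B) (B \<rightarrow>\<^sub>E carrier K) (carrier V)"
    unfolding bij_betw_def
  proof
    show img: "(\<lambda>a. lincomb a B) ` (B \<rightarrow>\<^sub>E carrier K) = carrier V"
    proof
      show "(\<lambda>a. lincomb a B) ` (B \<rightarrow>\<^sub>E carrier K) \<subseteq> carrier V"
        using lincomb_closed[OF BV] by (auto simp: PiE_def)
      show "carrier V \<subseteq> (\<lambda>a. lincomb a B) ` (B \<rightarrow>\<^sub>E carrier K)" using * by blast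
    qed
    show "inj_on (\<lambda>a. lincomb a B) (B \<rightarrow>\<^sub>E carrier K)"
      using * img by (intro inj_onI) (metis imageI)
  qed
  then have "card (B \<rightarrow>\<^sub>E carrier K) = card (carrier V)" by (rule bij_betw_same_card)
  then show ?thesis using B by (simp add: card_PiE dim_basis)
qed

section \<open>Polynomial functions over a finite field\<close>

text \<open>Polynomial functions appear in two shapes below: in the coordinates of a point, and as
  expansions in auxiliary variables with polynomial coefficients. Both are sums of terms of bounded
  degree.\<close>

locale graded_functions = cring R for R (structure) +
  fixes S :: "'s set" and M :: "nat \<Rightarrow> ('s \<Rightarrow> 'a) set"
  assumes term_closed: "m \<in> M D \<Longrightarrow> s \<in> S \<Longrightarrow> m s \<in> carrier R"
    and term_const: "c \<in> carrier R \<Longrightarrow> \<exists>m\<in>M 0. \<forall>s\<in>S. m s = c"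
    and term_mult: "m \<in> M D \<Longrightarrow> m' \<in> M D' \<Longrightarrow> \<exists>m''\<in>M (D + D'). \<forall>s\<in>S. m'' s = m s \<otimes> m' s"
    and term_mono: "D \<le> D' \<Longrightarrow> M D \<subseteq> M D'"
begin

text \<open>Finite sums of terms, built one term at a time so that statements about sums reduce to
  single terms by induction. Both rules constrain \<open>g\<close> only on \<open>S\<close>, so
  membership depends only on the values there.\<close>

inductive gr :: "nat \<Rightarrow> ('s \<Rightarrow> 'a) \<Rightarrow> bool" for D where
  gr_zero: "(\<And>s. s \<in> S \<Longrightarrow> g s = \<zero>) \<Longrightarrow> gr D g"
| gr_add_term: "m \<in> M D \<Longrightarrow> gr D h \<Longrightarrow> (\<And>s. s \<in> S \<Longrightarrow> g s = m s \<oplus> h s) \<Longrightarrow> gr D g"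

lemma gr_closed: "gr D g \<Longrightarrow> s \<in> S \<Longrightarrow> g s \<in> carrier R"
  by (induction rule: gr.induct) (use term_closed in auto)

lemma gr_cong: "gr D g \<Longrightarrow> (\<And>s. s \<in> S \<Longrightarrow> g s = g' s) \<Longrightarrow> gr D g'"
  by (erule gr.cases) (auto intro: gr_zero gr_add_term)

lemma gr_term: "m \<in> M D \<Longrightarrow> gr D m"
  by (rule gr_add_term[of m D "\<lambda>_. \<zero>"]) (use term_closed in \<open>auto intro: gr_zero\<close>)

lemma gr_mono: "gr D g \<Longrightarrow> D \<le> D' \<Longrightarrow> gr D' g"
proof (induction rule: gr.induct)
  case (gr_add_term m h g)
  then show ?case using term_mono by (blast intro: gr.gr_add_term)
qed (rule gr_zero)

lemma gr_const: "c \<in> carrier R \<Longrightarrow> gr D (\<lambda>_. c)"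
  using term_const[of c] by (auto intro: gr_mono[OF gr_cong[OF gr_term]])

lemma gr_add: "gr D g \<Longrightarrow> gr D h \<Longrightarrow> gr D (\<lambda>s. g s \<oplus> h s)"
proof (induction rule: gr.induct)
  case (gr_zero g)
  then show ?case by (auto intro: gr_cong[OF gr_zero(2)] simp: gr_closed)
next
  case (gr_add_term m h' g)
  show ?case
    by (rule gr.gr_add_term[OF gr_add_term(1) gr_add_term(4)[OF gr_add_term(5)]])
      (use gr_add_term term_closed gr_closed in \<open>auto simp: a_assoc Pi_iff\<close>)
qed

lemma gr_term_mult: "gr D' h \<Longrightarrow> m \<in> M D \<Longrightarrow> gr (D + D') (\<lambda>s. m s \<otimes> h s)"
proof (induction rule: gr.induct)
  case (gr_zero g)
  then show ?case using term_closed by (intro gr.gr_zero) (auto simp: Pi_iff)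
next
  case (gr_add_term m' h g)
  obtain m'' where m'': "m'' \<in> M (D + D')" "\<forall>s\<in>S. m'' s = m s \<otimes> m' s"
    using term_mult[OF gr_add_term(5,1)] by blast
  show ?case
    by (rule gr.gr_add_term[OF m''(1) gr_add_term(4)[OF gr_add_term(5)]])
      (use m'' gr_add_term gr_closed term_closed in \<open>auto simp: r_distr Pi_iff\<close>)
qed

lemma gr_mult: "gr D g \<Longrightarrow> gr D' h \<Longrightarrow> gr (D + D') (\<lambda>s. g s \<otimes> h s)"
proof (induction rule: gr.induct)
  case (gr_zero g)
  then show ?case by (intro gr.gr_zero) (auto simp: gr_closed)
next
  case (gr_add_term m h' g)
  show ?case
    by (rule gr_cong[OF gr_add[OF gr_term_mult[OF gr_add_term(5,1)] gr_add_term(4)[OF gr_add_term(5)]]])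
      (use gr_add_term gr_closed term_closed in \<open>auto simp: l_distr Pi_iff\<close>)
qed

lemma gr_pow: "gr D g \<Longrightarrow> gr (D * k) (\<lambda>s. g s [^] (k :: nat))"
proof (induction k)
  case (Suc k)
  have "gr (D * k + D) (\<lambda>s. g s [^] k \<otimes> g s)" using Suc gr_mult by blast
  then show ?case by (simp add: add.commute)
qed (simp add: gr_const)

lemma gr_finprod:
  assumes "finite I" "\<And>i. i \<in> I \<Longrightarrow> gr (D i) (g i)"
  shows "gr (\<Sum>i\<in>I. D i) (\<lambda>s. \<Otimes>i\<in>I. g i s)"
  using assms
proof (induction I rule: finite_induct)
  case (insert i I)
  have "gr (D i + (\<Sum>i\<in>I. D i)) (\<lambda>s. g i s \<otimes> (\<Otimes>i\<in>I. g i s))"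
    using insert gr_mult by blast
  then show ?case
    unfolding sum.insert[OF insert.hyps(1,2)]
    by (rule gr_cong) (subst finprod_insert, use insert gr_closed in \<open>auto simp: Pi_iff\<close>)
qed (simp add: gr_const)

lemma gr_finsum:
  assumes "finite I" "\<And>i. i \<in> I \<Longrightarrow> gr D (g i)"
  shows "gr D (\<lambda>s. \<Oplus>i\<in>I. g i s)"
  using assms
proof (induction I rule: finite_induct)
  case (insert i I)
  have "gr D (\<lambda>s. g i s \<oplus> (\<Oplus>i\<in>I. g i s))"
    using insert gr_add by blast
  then show ?case
    by (rule gr_cong) (subst finsum_insert, use insert gr_closed in \<open>auto simp: Pi_iff\<close>)
qed (simp add: gr_const)

lemma gr_minus_const: "gr D g \<Longrightarrow> c \<in> carrier R \<Longrightarrow> gr D (\<lambda>s. g s \<ominus> c)"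
  unfolding minus_eq by (intro gr_add gr_const) auto

lemma gr_const_minus:
  assumes "gr D g" "c \<in> carrier R"
  shows "gr D (\<lambda>s. c \<ominus> g s)"
proof -
  have "gr (0 + D) (\<lambda>s. \<ominus> \<one> \<otimes> g s)" by (intro gr_mult gr_const assms) auto
  then have "gr D (\<lambda>s. c \<oplus> \<ominus> \<one> \<otimes> g s)" by (intro gr_add gr_const) (simp_all add: assms)
  then show ?thesis
    by (rule gr_cong) (use assms gr_closed in \<open>auto simp: minus_eq l_minus\<close>)
qed

end

locale finite_field = field R for R :: "'a ring" (structure) +
  assumes finite_carrier: "finite (carrier R)"
begin

abbreviation V :: "nat \<Rightarrow> (nat \<Rightarrow> 'a) set" where "V n \<equiv> {..<n} \<rightarrow>\<^sub>E carrier R"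
abbreviation q where "q \<equiv> card (carrier R)"

text \<open>Exponents of any size are allowed, so products of monomials need no reduction. Bounding
  the degree instead of fixing it makes the family increasing in \<open>D\<close>.\<close>

definition mons :: "nat \<Rightarrow> nat \<Rightarrow> ((nat \<Rightarrow> 'a) \<Rightarrow> 'a) set" where
  "mons n D = {\<lambda>x. c \<otimes> (\<Otimes>i\<in>{..<n}. x i [^] (e i :: nat)) | c e. c \<in> carrier R \<and> (\<Sum>i<n. e i) \<le> D}"

lemma monomial_closed: "x \<in> V n \<Longrightarrow> (\<Otimes>i\<in>{..<n}. x i [^] (e i :: nat)) \<in> carrier R"
  by (intro finprod_closed) auto

text \<open>The functions represented on F^n by some polynomial of total degree at most the given
  bound. Such a polynomial is not unique, since \<open>x^q = x\<close> on the field.\<close>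

abbreviation "pol n \<equiv> graded_functions.gr R (V n) (mons n)"

lemma graded_pol: "graded_functions R (V n) (mons n)"
proof (intro graded_functions.intro graded_functions_axioms.intro is_cring)
  fix m D s assume "m \<in> mons n D" "s \<in> V n"
  then obtain c e where "m = (\<lambda>x. c \<otimes> (\<Otimes>i\<in>{..<n}. x i [^] (e i :: nat)))" "c \<in> carrier R"
    unfolding mons_def by blast
  then show "m s \<in> carrier R"
    using monomial_closed[OF \<open>s \<in> V n\<close>, of e] by simp
next
  fix c assume "c \<in> carrier R"
  then show "\<exists>m\<in>mons n 0. \<forall>s\<in>V n. m s = c"
    by (intro bexI[of _ "\<lambda>x. c \<otimes> (\<Otimes>i\<in>{..<n}. x i [^] (0::nat))"])
      (auto simp: mons_def intro!: exI[of _ c] exI[of _ "\<lambda>_. 0"])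
next
  fix m D m' D' assume "m \<in> mons n D" "m' \<in> mons n D'"
  then obtain c e c' e' where m: "m = (\<lambda>x. c \<otimes> (\<Otimes>i\<in>{..<n}. x i [^] (e i :: nat)))"
      "c \<in> carrier R" "(\<Sum>i<n. e i) \<le> D"
    and m': "m' = (\<lambda>x. c' \<otimes> (\<Otimes>i\<in>{..<n}. x i [^] (e' i :: nat)))"
      "c' \<in> carrier R" "(\<Sum>i<n. e' i) \<le> D'"
    unfolding mons_def by auto
  show "\<exists>m''\<in>mons n (D + D'). \<forall>s\<in>V n. m'' s = m s \<otimes> m' s"
  proof (intro bexI ballI)
    fix x assume x: "x \<in> V n"
    have "(\<Otimes>i\<in>{..<n}. x i [^] (e i + e' i)) = (\<Otimes>i\<in>{..<n}. x i [^] (e i) \<otimes> x i [^] (e' i))"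
      using x by (intro finprod_cong) (auto simp: nat_pow_mult PiE_iff simp_implies_def)
    also have "\<dots> = (\<Otimes>i\<in>{..<n}. x i [^] (e i)) \<otimes> (\<Otimes>i\<in>{..<n}. x i [^] (e' i))"
      using x by (intro finprod_multf) auto
    finally show "(c \<otimes> c') \<otimes> (\<Otimes>i\<in>{..<n}. x i [^] (e i + e' i)) = m x \<otimes> m' x"
      using monomial_closed[OF x, of e] monomial_closed[OF x, of e'] m m' by (simp add: m_ac)
  next
    show "(\<lambda>x. (c \<otimes> c') \<otimes> (\<Otimes>i\<in>{..<n}. x i [^] (e i + e' i))) \<in> mons n (D + D')"
      using m m' by (auto simp: mons_def sum.distrib intro!: exI[of _ "c \<otimes> c'"] exI[of _ "\<lambda>i. e i + e' i"])
  qed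
next
  fix D D' :: nat assume "D \<le> D'"
  then show "mons n D \<subseteq> mons n D'" by (fastforce simp: mons_def)
qed

lemmas pol_closed = graded_functions.gr_closed[OF graded_pol]
  and pol_cong = graded_functions.gr_cong[OF graded_pol]
  and pol_term = graded_functions.gr_term[OF graded_pol]
  and pol_mono = graded_functions.gr_mono[OF graded_pol]
  and pol_const = graded_functions.gr_const[OF graded_pol]
  and pol_add = graded_functions.gr_add[OF graded_pol]
  and pol_mult = graded_functions.gr_mult[OF graded_pol]
  and pol_pow = graded_functions.gr_pow[OF graded_pol]
  and pol_finprod = graded_functions.gr_finprod[OF graded_pol]
  and pol_finsum = graded_functions.gr_finsum[OF graded_pol]
  and pol_minus_const = graded_functions.gr_minus_const[OF graded_pol]
  and pol_const_minus = graded_functions.gr_const_minus[OF graded_pol]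
  and pol_zero = graded_functions.gr_zero[OF graded_pol]
  and pol_term_closed = graded_functions.term_closed[OF graded_pol]
  and pol_induct [consumes 1, case_names gr_zero gr_add_term] =
    graded_functions.gr.induct[OF graded_pol]

lemma pol_coord:
  assumes "i < n" shows "pol n 1 (\<lambda>x. x i)"
proof -
  define e where "e j = (if j = i then 1 else 0 :: nat)" for j
  have "(\<Sum>j<n. e j) = 1" unfolding e_def using assms by (subst sum.delta) auto
  then have "pol n 1 (\<lambda>x. \<one> \<otimes> (\<Otimes>i\<in>{..<n}. x i [^] e i))"
    by (intro pol_term) (unfold mons_def, auto intro!: exI[of _ \<one>] exI[of _ e])
  then show ?thesis
  proof (rule pol_cong)
    fix x assume x: "x \<in> V n"
    have "(\<Otimes>j\<in>{..<n}. x j [^] e j) = (\<Otimes>j\<in>{..<n}. if i = j then x j else \<one>)"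
      using x by (intro finprod_cong) (auto simp: e_def PiE_iff simp_implies_def)
    also have "\<dots> = x i" using x assms by (intro finprod_singleton) auto
    finally show "\<one> \<otimes> (\<Otimes>j\<in>{..<n}. x j [^] e j) = x i"
      using PiE_mem[OF x, of i] assms by simp
  qed
qed

lemma pol_monomial: "pol n (\<Sum>i<n. e i) (\<lambda>x. \<Otimes>i\<in>{..<n}. x i [^] (e i :: nat))"
  by (rule pol_finprod) (use pol_pow[OF pol_coord] in auto)

section \<open>Sums of polynomial functions over all points\<close>

lemma finite_V: "finite (V n)"
  by (intro finite_PiE) (auto simp: finite_carrier)

lemma card_V: "card (V n) = q ^ n"
  by (simp add: card_PiE)

lemma q_gt_1: "q > 1"
proof -
  have "card {\<zero>, \<one>} \<le> q" by (intro card_mono finite_carrier) auto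
  then show ?thesis by simp
qed

lemma pow_q_minus_1:
  assumes "a \<in> carrier R" "a \<noteq> \<zero>" shows "a [^] (q - 1) = \<one>"
proof -
  interpret G: group "mult_of R" by (rule field_mult_group)
  have "a [^]\<^bsub>mult_of R\<^esub> order (mult_of R) = \<one>\<^bsub>mult_of R\<^esub>"
    by (rule G.pow_order_eq_1) (use assms in auto)
  then show ?thesis
    using finite_carrier by (simp add: order_mult_of order_def nat_pow_mult_of)
qed

text \<open>The equation \<open>x^e = 1\<close> has at most \<open>e\<close> solutions, fewer than
  the \<open>q - 1\<close> nonzero elements.\<close>

lemma primitive_power_neq_1:
  assumes "0 < e" "e < q - 1"
  obtains g where "g \<in> carrier R" "g \<noteq> \<zero>" "g [^] e \<noteq> \<one>"
proof -
  have "\<not> carrier R - {\<zero>} \<subseteq> {x \<in> carrier R. x [^] e = \<one>}"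
  proof
    assume "carrier R - {\<zero>} \<subseteq> {x \<in> carrier R. x [^] e = \<one>}"
    then have "card (carrier R - {\<zero>}) \<le> card {x \<in> carrier R. x [^] e = \<one>}"
      using finite_carrier by (intro card_mono) auto
    also have "\<dots> \<le> e"
      using num_roots_le_deg[OF finite_carrier, of e] assms by simp
    finally show False using assms finite_carrier by (simp add: card_Diff_singleton)
  qed
  then show ?thesis using that by blast
qed

lemma sum_monomials_scaled:
  assumes "i < n" "g \<in> carrier R" "x \<in> V n"
  shows "(\<Otimes>j\<in>{..<n}. (x(i := g \<otimes> x i)) j [^] (e j :: nat))
    = g [^] e i \<otimes> (\<Otimes>j\<in>{..<n}. x j [^] e j)"
proof -
  have I: "{..<n} = insert i ({..<n} - {i})" using assms by auto
  have xi: "x j \<in> carrier R" if "j < n" for j using PiE_mem[OF assms(3)] that by simp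
  have "(\<Otimes>j\<in>{..<n} - {i}. (x(i := g \<otimes> x i)) j [^] e j) = (\<Otimes>j\<in>{..<n} - {i}. x j [^] e j)"
    by (intro finprod_cong) (auto simp: xi simp_implies_def)
  then show ?thesis
    by (subst (1 2) I, subst (1 2) finprod_insert)
      (use assms xi in \<open>auto simp: nat_pow_distrib m_assoc\<close>)
qed

lemma bij_update:
  assumes "i < n" "h \<in> carrier R \<rightarrow> carrier R" "inj_on h (carrier R)"
  shows "bij_betw (\<lambda>x. x(i := h (x i))) (V n) (V n)"
proof -
  have inj: "inj_on (\<lambda>x. x(i := h (x i))) (V n)"
  proof (rule inj_onI)
    fix x y assume x: "x \<in> V n" and y: "y \<in> V n" and eq: "x(i := h (x i)) = y(i := h (y i))"
    have "x i = y i"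
      using fun_cong[OF eq, of i] PiE_mem[OF x, of i] PiE_mem[OF y, of i] assms
      by (auto dest: inj_onD)
    moreover have "x j = y j" if "j \<noteq> i" for j using fun_cong[OF eq, of j] that by simp
    ultimately show "x = y" by (metis ext)
  qed
  moreover have "(\<lambda>x. x(i := h (x i))) ` V n \<subseteq> V n"
    using assms by (auto simp: PiE_iff extensional_def)
  ultimately show ?thesis
    using endo_inj_surj[OF finite_V] by (simp add: bij_betw_def)
qed

lemma sum_reindex_update:
  assumes "i < n" "h \<in> carrier R \<rightarrow> carrier R" "inj_on h (carrier R)" "f \<in> V n \<rightarrow> carrier R"
  shows "(\<Oplus>x\<in>V n. f (x(i := h (x i)))) = (\<Oplus>x\<in>V n. f x)"
  using bij_update[OF assms(1-3)] finsum_reindex[of f "\<lambda>x. x(i := h (x i))" "V n"] assms(4)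
  by (simp add: bij_betw_def)

text \<open>Substituting $x_i \mapsto g x_i$ multiplies the sum by $g^{e_i}$; if $e_i = 0$, substituting
  $x_i \mapsto x_i + 1$ in the sum of $x_i \prod_j x_j^{e_j}$ adds the sum in question.\<close>

lemma sum_monomial_eq_zero:
  assumes i: "i < n" and e: "e i < q - 1"
  shows "(\<Oplus>x\<in>V n. \<Otimes>j\<in>{..<n}. x j [^] (e j :: nat)) = \<zero>"
proof -
  define mon where "mon x = (\<Otimes>j\<in>{..<n}. x j [^] e j)" for x
  define T where "T = (\<Oplus>x\<in>V n. mon x)"
  have mon: "mon \<in> V n \<rightarrow> carrier R" using monomial_closed by (auto simp: mon_def)
  have T: "T \<in> carrier R" unfolding T_def using mon by simp
  have xi: "x i \<in> carrier R" if "x \<in> V n" for x using PiE_mem[OF that] i by simp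
  have "T = \<zero>"
  proof (cases "e i = 0")
    case False
    then obtain g where g: "g \<in> carrier R" "g \<noteq> \<zero>" "g [^] e i \<noteq> \<one>"
      using primitive_power_neq_1 e by blast
    have "T = (\<Oplus>x\<in>V n. mon (x(i := g \<otimes> x i)))"
      unfolding T_def using g mon i m_lcancel
      by (intro sum_reindex_update[symmetric]) (auto intro!: inj_onI)
    also have "\<dots> = (\<Oplus>x\<in>V n. g [^] e i \<otimes> mon x)"
      using sum_monomials_scaled[OF i g(1)] mon g
      by (intro finsum_cong) (auto simp: mon_def simp_implies_def Pi_iff)
    also have "\<dots> = g [^] e i \<otimes> T"
      unfolding T_def using mon g by (intro finsum_rdistr[symmetric] finite_V) auto
    finally have "(g [^] e i \<ominus> \<one>) \<otimes> T = \<zero>"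
      using g T by (simp add: minus_eq l_distr l_minus r_neg)
    moreover have "g [^] e i \<ominus> \<one> \<noteq> \<zero>" using g by (simp add: r_right_minus_eq)
    ultimately show ?thesis using integral[of "g [^] e i \<ominus> \<one>" T] g T by auto
  next
    case True
    have mon': "mon (x(i := a)) = mon x" if "x \<in> V n" "a \<in> carrier R" for x a
    proof -
      have "x j \<in> carrier R" if "j < n" for j using PiE_mem[OF \<open>x \<in> V n\<close>] that by simp
      then show ?thesis
        unfolding mon_def using True by (intro finprod_cong) (auto simp: simp_implies_def)
    qed
    \<comment> \<open>One expects the free coordinate to contribute a factor q = 0. The auxiliary
      sum gives the same cancellation in the form \<open>T' = T' \<oplus> T\<close>, without mention
      of the characteristic.\<close>
    define T' where "T' = (\<Oplus>x\<in>V n. x i \<otimes> mon x)"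
    have T': "T' \<in> carrier R" unfolding T'_def using mon xi by (intro finsum_closed) auto
    have "T' = (\<Oplus>x\<in>V n. (x(i := x i \<oplus> \<one>)) i \<otimes> mon (x(i := x i \<oplus> \<one>)))"
      unfolding T'_def using mon xi i
      by (intro sum_reindex_update[symmetric]) (auto intro!: inj_onI)
    also have "\<dots> = (\<Oplus>x\<in>V n. x i \<otimes> mon x \<oplus> mon x)"
      using mon xi mon' by (intro finsum_cong) (auto simp: l_distr simp_implies_def Pi_iff)
    also have "\<dots> = T' \<oplus> T"
      unfolding T_def T'_def using mon xi by (intro finsum_addf) auto
    finally show ?thesis using T T' by (simp add: add.l_cancel_one')
  qed
  then show ?thesis by (simp add: T_def mon_def)
qed

text \<open>By pigeonhole, a monomial of degree below \<open>n * (q - 1)\<close> has an exponent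
  below \<open>q - 1\<close>, and this makes its sum vanish.\<close>

lemma sum_pol_eq_zero:
  assumes "pol n D g" "D < n * (q - 1)"
  shows "(\<Oplus>x\<in>V n. g x) = \<zero>"
  using assms(1)
proof (induction rule: pol_induct)
  case (gr_zero g)
  then show ?case by (simp cong: finsum_cong')
next
  case (gr_add_term m h g)
  obtain c e where m: "m = (\<lambda>x. c \<otimes> (\<Otimes>i\<in>{..<n}. x i [^] (e i :: nat)))" "c \<in> carrier R"
      and e: "(\<Sum>i<n. e i) \<le> D"
    using gr_add_term(1) unfolding mons_def by blast
  have "\<exists>i<n. e i < q - 1"
  proof (rule ccontr)
    assume "\<not> (\<exists>i<n. e i < q - 1)"
    then have "(\<Sum>i<n. q - 1) \<le> (\<Sum>i<n. e i)" by (intro sum_mono) (meson lessThan_iff not_le)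
    then show False using e assms by simp
  qed
  then obtain i where i: "i < n" "e i < q - 1" by blast
  have "(\<Oplus>x\<in>V n. m x) = c \<otimes> (\<Oplus>x\<in>V n. \<Otimes>i\<in>{..<n}. x i [^] e i)"
    unfolding m(1) by (intro finsum_rdistr[symmetric] finite_V m(2)) (auto simp: monomial_closed)
  then have m0: "(\<Oplus>x\<in>V n. m x) = \<zero>" using sum_monomial_eq_zero[where e = e, OF i] m by simp
  have "(\<Oplus>x\<in>V n. g x) = (\<Oplus>x\<in>V n. m x \<oplus> h x)"
    using gr_add_term(1,2,3) pol_term_closed pol_closed
    by (intro finsum_cong') auto
  also have "\<dots> = (\<Oplus>x\<in>V n. m x) \<oplus> (\<Oplus>x\<in>V n. h x)"
    using gr_add_term(1,2) pol_term_closed pol_closed by (intro finsum_addf) auto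
  finally show ?case using m0 gr_add_term by simp
qed

section \<open>The Chevalley--Warning theorem\<close>

text \<open>If \<open>z\<close> were the only common zero, the product of the factors
  \<open>1 - Q_t^(q - 1)\<close> would be the indicator function of \<open>z\<close>, with sum 1
  over F^n. Its degree is below \<open>n * (q - 1)\<close>, so that sum is 0. Only a second zero is
  wanted, so comparing 1 with 0 replaces the usual count of zeros modulo the characteristic.\<close>

theorem chevalley_warning:
  assumes T: "finite T" and Q: "\<And>t. t \<in> T \<Longrightarrow> pol n (D t) (Q t)"
    and D: "(\<Sum>t\<in>T. D t) < n" and z: "z \<in> V n" "\<And>t. t \<in> T \<Longrightarrow> Q t z = \<zero>"
  shows "\<exists>x\<in>V n. x \<noteq> z \<and> (\<forall>t\<in>T. Q t x = \<zero>)"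
proof (rule ccontr)
  assume "\<not> ?thesis"
  then have *: "\<forall>x\<in>V n. x \<noteq> z \<longrightarrow> (\<exists>t\<in>T. Q t x \<noteq> \<zero>)" by metis
  define g where "g x = (\<Otimes>t\<in>T. \<one> \<ominus> Q t x [^] (q - 1))" for x
  have "pol n (\<Sum>t\<in>T. D t * (q - 1)) g"
    unfolding g_def by (intro pol_finprod T pol_const_minus pol_pow Q) auto
  moreover have "(\<Sum>t\<in>T. D t * (q - 1)) < n * (q - 1)"
    using D q_gt_1 by (simp flip: sum_distrib_right)
  ultimately have "(\<Oplus>x\<in>V n. g x) = \<zero>" by (rule sum_pol_eq_zero)
  moreover have "g x = (if z = x then \<one> else \<zero>)" if x: "x \<in> V n" for x
  proof (cases "z = x")
    case True
    have "g z = \<one>"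
      unfolding g_def
    proof (rule finprod_one_eqI)
      show "\<one> \<ominus> Q t z [^] (q - 1) = \<one>" if "t \<in> T" for t
        using z(2)[OF that] q_gt_1 by (simp add: nat_pow_zero minus_eq)
    qed
    then show ?thesis using True by simp
  next
    case False
    with *[rule_format, OF x]
    obtain t where t: "t \<in> T" "Q t x \<noteq> \<zero>" by metis
    have Qx: "Q t x \<in> carrier R" if "t \<in> T" for t using pol_closed[OF Q[OF that] x] .
    have Teq: "T = insert t (T - {t})" using t by auto
    have "g x = (\<one> \<ominus> Q t x [^] (q - 1)) \<otimes> (\<Otimes>t\<in>T - {t}. \<one> \<ominus> Q t x [^] (q - 1))"
      unfolding g_def using T Qx t
      by (subst Teq, subst finprod_insert) auto
    also have "\<dots> = \<zero>"
      using t Qx pow_q_minus_1[of "Q t x"] by (simp add: minus_eq r_neg)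
    finally show ?thesis using False by simp
  qed
  then have "(\<Oplus>x\<in>V n. g x) = (\<Oplus>x\<in>V n. if z = x then \<one> else \<zero>)"
    by (intro finsum_cong') auto
  moreover have "(\<Oplus>x\<in>V n. if z = x then \<one> else \<zero>) = \<one>"
    using z by (intro finsum_singleton finite_V) auto
  ultimately show False by simp
qed

section \<open>Reduced coefficients and degree\<close>

lemma finsum_update:
  assumes "finite I" "r \<in> I" "c \<in> I \<rightarrow> carrier R" "m \<in> I \<rightarrow> carrier R" "a \<in> carrier R"
  shows "(\<Oplus>e\<in>I. (c(r := c r \<oplus> a)) e \<otimes> m e) = a \<otimes> m r \<oplus> (\<Oplus>e\<in>I. c e \<otimes> m e)"
proof -
  have "(\<Oplus>e\<in>I. (c(r := c r \<oplus> a)) e \<otimes> m e)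
      = (\<Oplus>e\<in>I. (if r = e then a \<otimes> m e else \<zero>) \<oplus> c e \<otimes> m e)"
    using assms by (intro finsum_cong') (auto simp: l_distr a_comm Pi_iff)
  also have "\<dots> = (\<Oplus>e\<in>I. if r = e then a \<otimes> m e else \<zero>) \<oplus> (\<Oplus>e\<in>I. c e \<otimes> m e)"
    using assms by (intro finsum_addf) (auto simp: Pi_iff)
  also have "(\<Oplus>e\<in>I. if r = e then a \<otimes> m e else \<zero>) = a \<otimes> m r"
    using assms by (intro finsum_singleton) (auto simp: Pi_iff)
  finally show ?thesis .
qed

lemma pow_reduce:
  assumes "a \<in> carrier R"
  shows "\<exists>r<q. \<forall>a\<in>carrier R. a [^] (e :: nat) = a [^] r"
proof (induction e rule: less_induct)
  case (less e)
  show ?case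
  proof (cases "e < q")
    case False
    \<comment> \<open>The exponent \<open>e - q + 1\<close> is still positive, so the two powers
      also agree at 0.\<close>
    then have e: "e - q + 1 < e" using q_gt_1 by linarith
    have "a [^] e = a [^] (e - q + 1)" if a: "a \<in> carrier R" for a
    proof (cases "a = \<zero>")
      case True
      then show ?thesis using False q_gt_1 by (simp add: nat_pow_zero)
    next
      case False': False
      have "a [^] e = a [^] ((e - q + 1) + (q - 1))" using False q_gt_1 by simp
      also have "\<dots> = a [^] (e - q + 1)"
        unfolding nat_pow_mult[OF a, symmetric] pow_q_minus_1[OF a False'] using a by simp
      finally show ?thesis .
    qed
    then show ?thesis using less[OF e] by metis
  qed auto
qed

abbreviation "monomial n e x \<equiv> (\<Otimes>i\<in>{..<n}. x i [^] (e i :: nat))"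

lemma finite_reduced_exponents: "finite (reduced_exponents R n)"
  unfolding reduced_exponents_def by (intro finite_PiE) auto

lemma monomial_reduce: "\<exists>r\<in>reduced_exponents R n. \<forall>x\<in>V n. monomial n e x = monomial n r x"
proof -
  obtain red where red: "red k < q" "\<And>a. a \<in> carrier R \<Longrightarrow> a [^] k = a [^] red k" for k :: nat
    using pow_reduce[OF zero_closed] by metis
  show ?thesis
  proof (intro bexI ballI)
    fix x assume x: "x \<in> V n"
    have "x i \<in> carrier R" if "i < n" for i using PiE_mem[OF x] that by simp
    then show "monomial n e x = monomial n (\<lambda>i\<in>{..<n}. red (e i)) x"
      by (intro finprod_cong) (auto simp: simp_implies_def intro: red(2))
  qed (auto simp: reduced_exponents_def red split: if_splits)
qed

text \<open>The existence half of the reduced representation: reduce each monomial and add its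
  coefficient at the resulting exponent vector. The bound \<open>D\<close> is not carried along,
  because the degree is read off the reduced coefficients afterwards.\<close>

lemma pol_imp_poly_eval:
  "pol n D g \<Longrightarrow> \<exists>c\<in>reduced_exponents R n \<rightarrow>\<^sub>E carrier R. \<forall>x\<in>V n. poly_eval R n c x = g x"
proof (induction rule: pol_induct)
  case (gr_zero g)
  show ?case
  proof (intro bexI ballI)
    fix x assume x: "x \<in> V n"
    have "poly_eval R n (\<lambda>e\<in>reduced_exponents R n. \<zero>) x = (\<Oplus>e\<in>reduced_exponents R n. \<zero>)"
      unfolding poly_eval_def by (intro finsum_cong') (auto simp: monomial_closed[OF x])
    then show "poly_eval R n (\<lambda>e\<in>reduced_exponents R n. \<zero>) x = g x" using gr_zero x by simp
  qed auto
next
  case (gr_add_term m h g)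
  obtain a e where m: "m = (\<lambda>x. a \<otimes> monomial n e x)" "a \<in> carrier R"
    using gr_add_term(1) unfolding mons_def by blast
  obtain r where r: "r \<in> reduced_exponents R n" and r': "\<forall>x\<in>V n. monomial n e x = monomial n r x"
    using monomial_reduce[of n e] by (elim bexE)
  obtain c where c: "c \<in> reduced_exponents R n \<rightarrow>\<^sub>E carrier R"
    and c': "\<forall>x\<in>V n. poly_eval R n c x = h x" using gr_add_term(4) by (elim bexE)
  have cc: "c \<in> reduced_exponents R n \<rightarrow> carrier R" using c by auto
  show ?case
  proof (intro bexI ballI)
    fix x assume x: "x \<in> V n"
    have "poly_eval R n (c(r := c r \<oplus> a)) x = a \<otimes> monomial n r x \<oplus> poly_eval R n c x"
      unfolding poly_eval_def
      by (rule finsum_update[OF finite_reduced_exponents r cc _ m(2)]) (auto simp: monomial_closed[OF x])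
    then show "poly_eval R n (c(r := c r \<oplus> a)) x = g x"
      using gr_add_term(3)[OF x] bspec[OF c' x] bspec[OF r' x] m(1) by simp
  next
    show "c(r := c r \<oplus> a) \<in> reduced_exponents R n \<rightarrow>\<^sub>E carrier R"
      using c r m(2) cc by (auto simp: PiE_iff extensional_def Pi_iff)
  qed
qed

text \<open>Interpolation: \<open>ind z\<close> is the indicator function of the point
  \<open>z\<close>, and \<open>g\<close> is the sum of the \<open>ind z\<close> weighted by the
  values \<open>g z\<close>.\<close>

lemma pol_of_function:
  assumes g: "g \<in> V n \<rightarrow> carrier R"
  shows "pol n (n * (q - 1)) g"
proof -
  define ind where "ind z x = (\<Otimes>i\<in>{..<n}. \<one> \<ominus> (x i \<ominus> z i) [^] (q - 1))" for z x :: "nat \<Rightarrow> 'a"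
  have V: "x i \<in> carrier R" if "x \<in> V n" "i < n" for x i using PiE_mem[OF that(1)] that(2) by simp
  have ind: "ind z x = (if x = z then \<one> else \<zero>)" if z: "z \<in> V n" and x: "x \<in> V n" for z x
  proof (cases "x = z")
    case True
    have "ind z z = \<one>"
      unfolding ind_def
    proof (rule finprod_one_eqI)
      show "\<one> \<ominus> (z i \<ominus> z i) [^] (q - 1) = \<one>" if "i \<in> {..<n}" for i
        using V[OF z, of i] that q_gt_1 by (simp add: r_neg minus_eq nat_pow_zero)
    qed
    then show ?thesis using True by simp
  next
    case False
    then obtain i where i: "i < n" "x i \<noteq> z i" using PiE_ext[OF x z] by auto
    then have I: "{..<n} = insert i ({..<n} - {i})" by auto
    have "x i \<ominus> z i \<noteq> \<zero>" using i V[OF x] V[OF z] by (simp add: r_right_minus_eq)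
    then have z0: "\<one> \<ominus> (x i \<ominus> z i) [^] (q - 1) = \<zero>"
      using i V[OF x] V[OF z] pow_q_minus_1[of "x i \<ominus> z i"] by (simp add: r_right_minus_eq)
    have "ind z x = (\<one> \<ominus> (x i \<ominus> z i) [^] (q - 1)) \<otimes> (\<Otimes>i\<in>{..<n} - {i}. \<one> \<ominus> (x i \<ominus> z i) [^] (q - 1))"
      unfolding ind_def by (subst I, subst finprod_insert) (use V[OF x] V[OF z] i in auto)
    also have "\<dots> = \<zero>"
      unfolding z0 using V[OF x] V[OF z] by (intro l_null finprod_closed) auto
    finally show ?thesis using False by simp
  qed
  have polind: "pol n (n * (q - 1)) (ind z)" if z: "z \<in> V n" for z
  proof -
    have "pol n (\<Sum>i<n. 1 * (q - 1)) (ind z)"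
      unfolding ind_def
      by (intro pol_finprod pol_const_minus pol_pow pol_minus_const pol_coord)
        (use V[OF z] in auto)
    then show ?thesis by simp
  qed
  have "pol n (n * (q - 1)) (\<lambda>x. \<Oplus>z\<in>V n. g z \<otimes> ind z x)"
  proof (intro pol_finsum finite_V)
    fix z assume z: "z \<in> V n"
    have "pol n (0 + n * (q - 1)) (\<lambda>x. g z \<otimes> ind z x)"
      by (intro pol_mult pol_const polind z funcset_mem[OF g z])
    then show "pol n (n * (q - 1)) (\<lambda>x. g z \<otimes> ind z x)" by simp
  qed
  then show ?thesis
  proof (rule pol_cong)
    fix x assume x: "x \<in> V n"
    have "(\<Oplus>z\<in>V n. g z \<otimes> ind z x) = (\<Oplus>z\<in>V n. if x = z then g z else \<zero>)"
      using g x ind funcset_mem[OF g] by (intro finsum_cong') (auto simp del: PiE_iff)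
    also have "\<dots> = g x" using x g by (intro finsum_singleton finite_V) auto
    finally show "(\<Oplus>z\<in>V n. g z \<otimes> ind z x) = g x" .
  qed
qed

lemma poly_eval_closed:
  assumes "c \<in> reduced_exponents R n \<rightarrow> carrier R" "x \<in> V n"
  shows "poly_eval R n c x \<in> carrier R"
  unfolding poly_eval_def using assms monomial_closed[OF assms(2)] by (intro finsum_closed) auto

text \<open>Uniqueness follows from existence, because there are as many reduced polynomials as functions.\<close>

lemma poly_eval_bij:
  "bij_betw (\<lambda>c. \<lambda>x\<in>V n. poly_eval R n c x) (reduced_exponents R n \<rightarrow>\<^sub>E carrier R) (V n \<rightarrow>\<^sub>E carrier R)"
    (is "bij_betw ?\<Phi> ?A ?B")
proof -
  have surj: "?\<Phi> ` ?A = ?B"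
  proof (intro equalityI subsetI)
    fix g assume g: "g \<in> ?B"
    then have "g \<in> V n \<rightarrow> carrier R" by (auto simp: PiE_iff)
    then obtain c where c: "c \<in> ?A" "\<And>x. x \<in> V n \<Longrightarrow> poly_eval R n c x = g x"
      using pol_imp_poly_eval[OF pol_of_function] by metis
    have "?\<Phi> c x = g x" for x
      using c(2)[of x] PiE_arb[OF g, of x] by (cases "x \<in> V n") simp_all
    then have "?\<Phi> c = g" by (rule ext)
    then show "g \<in> ?\<Phi> ` ?A" using c by blast
  next
    fix g assume "g \<in> ?\<Phi> ` ?A"
    then obtain c where c: "c \<in> ?A" "g = ?\<Phi> c" by blast
    then have "c \<in> reduced_exponents R n \<rightarrow> carrier R" by (simp add: PiE_def)
    then show "g \<in> ?B"
      unfolding c(2) restrict_PiE_iff using poly_eval_closed by blast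
  qed
  \<comment> \<open>Exponent vectors and points both number \<open>q^n\<close>, so there are
    \<open>q^(q^n)\<close> coefficient families and equally many functions; a surjection between
    them is injective.\<close>
  have "card (reduced_exponents R n) = card (V n)"
    by (simp add: reduced_exponents_def card_PiE)
  then have "card ?A = card ?B"
    by (simp add: card_PiE finite_V finite_reduced_exponents)
  moreover have "finite ?A"
    by (intro finite_PiE finite_reduced_exponents finite_carrier)
  ultimately have "inj_on ?\<Phi> ?A" using surj by (intro eq_card_imp_inj_on) auto
  then show ?thesis using surj by (simp add: bij_betw_def)
qed

lemma carrier_coord_space: "carrier (coord_space R n) = V n"
  by (simp add: func_space_def)

lemma reduced_coeffs_eqI:
  assumes "c \<in> reduced_exponents R n \<rightarrow>\<^sub>E carrier R" "\<And>x. x \<in> V n \<Longrightarrow> poly_eval R n c x = f x"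
  shows "reduced_coeffs R n f = c"
  unfolding reduced_coeffs_def carrier_coord_space
proof (rule the_equality)
  fix c' assume c': "c' \<in> reduced_exponents R n \<rightarrow>\<^sub>E carrier R \<and> (\<forall>x\<in>V n. poly_eval R n c' x = f x)"
  have "(\<lambda>x\<in>V n. poly_eval R n c' x) = (\<lambda>x\<in>V n. poly_eval R n c x)"
    using c' assms by (intro restrict_ext) metis
  then show "c' = c"
    using inj_onD[OF bij_betw_imp_inj_on[OF poly_eval_bij]] c' assms(1) by blast
qed (use assms in auto)

text \<open>Makes the zero function a test case in \<open>max_const_dim\<close>: every admissible
  dimension is then the dimension of an actual subspace.\<close>

lemma fun_degree_zero: "fun_degree R n (\<lambda>_. \<zero>) = 0"
proof -
  have "reduced_coeffs R n (\<lambda>_. \<zero>) = (\<lambda>e\<in>reduced_exponents R n. \<zero>)"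
  proof (rule reduced_coeffs_eqI)
    fix x assume x: "x \<in> V n"
    have "poly_eval R n (\<lambda>e\<in>reduced_exponents R n. \<zero>) x = (\<Oplus>e\<in>reduced_exponents R n. \<zero>)"
      unfolding poly_eval_def by (intro finsum_cong') (auto simp: monomial_closed[OF x])
    then show "poly_eval R n (\<lambda>e\<in>reduced_exponents R n. \<zero>) x = \<zero>" by simp
  qed auto
  then have "{e \<in> reduced_exponents R n. reduced_coeffs R n (\<lambda>_. \<zero>) e \<noteq> \<zero>} = {}" by auto
  then show ?thesis unfolding fun_degree_def by (simp only: image_empty Max_singleton)
qed

text \<open>The bridge from \<open>fun_degree\<close> to \<open>pol\<close>: the reduced polynomial
  is itself a sum of monomials within the bound. Exponents with coefficient 0 may exceed it and are
  treated apart.\<close>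

lemma pol_fun_degree:
  assumes f: "f \<in> V n \<rightarrow> carrier R"
  shows "pol n (fun_degree R n f) f"
proof -
  obtain c where c: "c \<in> reduced_exponents R n \<rightarrow>\<^sub>E carrier R" "\<And>x. x \<in> V n \<Longrightarrow> poly_eval R n c x = f x"
    using pol_imp_poly_eval[OF pol_of_function[OF f]] by metis
  have rc: "reduced_coeffs R n f = c" by (rule reduced_coeffs_eqI[OF c])
  define d where "d = fun_degree R n f"
  have deg: "(\<Sum>i<n. e i) \<le> d" if "e \<in> reduced_exponents R n" "c e \<noteq> \<zero>" for e
    unfolding d_def fun_degree_def rc
    using that finite_reduced_exponents[of n] by (intro Max_ge) auto
  have "pol n d (\<lambda>x. \<Oplus>e\<in>reduced_exponents R n. c e \<otimes> monomial n e x)"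
  proof (intro pol_finsum finite_reduced_exponents)
    fix e assume e: "e \<in> reduced_exponents R n"
    have ce: "c e \<in> carrier R" using PiE_mem[OF c(1) e] .
    show "pol n d (\<lambda>x. c e \<otimes> monomial n e x)"
    proof (cases "c e = \<zero>")
      case True
      then show ?thesis using monomial_closed by (intro pol_zero) simp
    next
      case False
      have "pol n (0 + (\<Sum>i<n. e i)) (\<lambda>x. c e \<otimes> monomial n e x)"
        by (intro pol_mult pol_const pol_monomial ce)
      then show ?thesis by (rule pol_mono) (use deg[OF e False] in simp)
    qed
  qed
  then show ?thesis
    unfolding d_def by (rule pol_cong) (simp add: c(2)[symmetric] poly_eval_def)
qed

section \<open>Expansion along a subspace\<close>

text \<open>An exponent vector of $b = (b_0, \dots, b_{k-1})$ is encoded as a list of length $k$.\<close>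

definition list_monomial :: "nat list \<Rightarrow> (nat \<Rightarrow> 'a) \<Rightarrow> 'a" where
  "list_monomial l b = (\<Otimes>j\<in>{..<length l}. b j [^] (l ! j))"

lemma list_monomial_closed: "b \<in> V (length l) \<Longrightarrow> list_monomial l b \<in> carrier R"
  unfolding list_monomial_def by (intro finprod_closed) auto

lemma list_monomial_mult:
  assumes "length l = length l'" "b \<in> V (length l)"
  shows "list_monomial (map2 (+) l l') b = list_monomial l b \<otimes> list_monomial l' b"
proof -
  have b: "b j \<in> carrier R" if "j < length l" for j using PiE_mem[OF assms(2)] that by simp
  have "list_monomial (map2 (+) l l') b = (\<Otimes>j\<in>{..<length l}. b j [^] (l ! j) \<otimes> b j [^] (l' ! j))"
    unfolding list_monomial_def using assms(1) b
    by (intro finprod_cong') (auto simp: nat_pow_mult)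
  also have "\<dots> = list_monomial l b \<otimes> list_monomial l' b"
    unfolding list_monomial_def assms(1)[symmetric] using b by (intro finprod_multf) auto
  finally show ?thesis .
qed

lemma list_monomial_replicate: "list_monomial (replicate k 0) b = \<one>"
  unfolding list_monomial_def by (rule finprod_one_eqI) simp

lemma list_monomial_unit:
  assumes "j < k" "b \<in> V k"
  shows "list_monomial ((replicate k 0)[j := 1]) b = b j"
proof -
  have b: "b i \<in> carrier R" if "i < k" for i using PiE_mem[OF assms(2)] that by simp
  have "list_monomial ((replicate k 0)[j := 1]) b = (\<Otimes>i\<in>{..<k}. if j = i then b i else \<one>)"
    unfolding list_monomial_def using b
    by (intro finprod_cong') (auto simp: nth_list_update)
  also have "\<dots> = b j" using b assms by (intro finprod_singleton) auto
  finally show ?thesis .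
qed

text \<open>The triple $(b, a, x)$ stands for the point $u + \sum_j b_j v_j + a x$. The exponent of \<open>a\<close> is
  bounded separately and does not count towards the degree in \<open>b\<close> and \<open>x\<close>.\<close>

definition mixed_terms :: "nat \<Rightarrow> nat \<Rightarrow> nat \<Rightarrow> ((nat \<Rightarrow> 'a) \<times> 'a \<times> (nat \<Rightarrow> 'a) \<Rightarrow> 'a) set" where
  "mixed_terms k n D =
    {\<lambda>(b, a, x). a [^] i \<otimes> list_monomial l b \<otimes> h x | i l h.
       i \<le> D \<and> length l = k \<and> sum_list l \<le> D \<and> pol n (D - sum_list l) h}"

lemma mixed_termsE:
  assumes "m \<in> mixed_terms k n D"
  obtains i l h where "m = (\<lambda>(b, a, x). a [^] (i::nat) \<otimes> list_monomial l b \<otimes> h x)" "i \<le> D"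
    "length l = k" "sum_list l \<le> D" "pol n (D - sum_list l) h"
  using assms unfolding mixed_terms_def by blast

lemma mixed_termsI:
  assumes "m = (\<lambda>(b, a, x). a [^] (i::nat) \<otimes> list_monomial l b \<otimes> h x)" "i \<le> D"
    "length l = k" "sum_list l \<le> D" "pol n (D - sum_list l) h"
  shows "m \<in> mixed_terms k n D"
  using assms unfolding mixed_terms_def by blast

lemma sum_list_map2_add:
  "length l = length l' \<Longrightarrow> sum_list (map2 (+) l l') = sum_list l + sum_list (l' :: nat list)"
  by (induction l l' rule: list_induct2) auto

abbreviation "mixed k n \<equiv> graded_functions.gr R (V k \<times> carrier R \<times> V n) (mixed_terms k n)"

lemma graded_mixed: "graded_functions R (V k \<times> carrier R \<times> V n) (mixed_terms k n)"
proof (intro graded_functions.intro graded_functions_axioms.intro is_cring)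
  fix m D s assume m: "m \<in> mixed_terms k n D" and s: "s \<in> V k \<times> carrier R \<times> V n"
  obtain b a x where s': "s = (b, a, x)" "b \<in> V k" "a \<in> carrier R" "x \<in> V n" using s by blast
  obtain i l h where "m = (\<lambda>(b, a, x). a [^] (i::nat) \<otimes> list_monomial l b \<otimes> h x)"
    "length l = k" "pol n (D - sum_list l) h"
    using m by (rule mixed_termsE)
  then show "m s \<in> carrier R"
    using s' list_monomial_closed[of b l] pol_closed[of n _ h x] by simp
next
  fix c assume c: "c \<in> carrier R"
  show "\<exists>m\<in>mixed_terms k n 0. \<forall>s\<in>V k \<times> carrier R \<times> V n. m s = c"
  proof (rule bexI)
    show "\<forall>s\<in>V k \<times> carrier R \<times> V n.
        (\<lambda>(b, a, x). a [^] (0::nat) \<otimes> list_monomial (replicate k 0) b \<otimes> c) s = c"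
      using c by (auto simp: list_monomial_replicate)
  qed (rule mixed_termsI[OF refl], use c in \<open>auto intro: pol_const simp: sum_list_replicate\<close>)
next
  fix m D m' D' assume "m \<in> mixed_terms k n D" "m' \<in> mixed_terms k n D'"
  obtain i l h where m: "m = (\<lambda>(b, a, x). a [^] (i::nat) \<otimes> list_monomial l b \<otimes> h x)" "i \<le> D"
    "length l = k" "sum_list l \<le> D" "pol n (D - sum_list l) h"
    using \<open>m \<in> mixed_terms k n D\<close> by (rule mixed_termsE)
  obtain i' l' h' where m': "m' = (\<lambda>(b, a, x). a [^] (i'::nat) \<otimes> list_monomial l' b \<otimes> h' x)" "i' \<le> D'"
    "length l' = k" "sum_list l' \<le> D'" "pol n (D' - sum_list l') h'"
    using \<open>m' \<in> mixed_terms k n D'\<close> by (rule mixed_termsE)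
  \<comment> \<open>The bounds \<open>sum_list l \<le> D\<close> and
    \<open>sum_list l' \<le> D'\<close> ensure that these truncated differences add up to the one
    required for the product.\<close>
  have "pol n ((D - sum_list l) + (D' - sum_list l')) (\<lambda>x. h x \<otimes> h' x)"
    using m m' by (intro pol_mult)
  then have pol: "pol n (D + D' - sum_list (map2 (+) l l')) (\<lambda>x. h x \<otimes> h' x)"
    using m m' by (simp add: sum_list_map2_add)
  show "\<exists>m''\<in>mixed_terms k n (D + D'). \<forall>s\<in>V k \<times> carrier R \<times> V n. m'' s = m s \<otimes> m' s"
  proof (rule bexI)
    show "\<forall>s\<in>V k \<times> carrier R \<times> V n. (\<lambda>(b, a, x). a [^] (i + i') \<otimes>
        list_monomial (map2 (+) l l') b \<otimes> (h x \<otimes> h' x)) s = m s \<otimes> m' s"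
    proof (intro ballI, clarify)
      fix b a x assume b: "b \<in> V k" and a: "a \<in> carrier R" and x: "x \<in> V n"
      have l: "length l = length l'" "b \<in> V (length l)" "b \<in> V (length l')" using m m' b by simp_all
      have closed: "list_monomial l b \<in> carrier R" "list_monomial l' b \<in> carrier R"
          "h x \<in> carrier R" "h' x \<in> carrier R"
        using list_monomial_closed[OF l(2)] list_monomial_closed[OF l(3)]
          pol_closed[OF m(5) x] pol_closed[OF m'(5) x] by simp_all
      show "a [^] (i + i') \<otimes> list_monomial (map2 (+) l l') b \<otimes> (h x \<otimes> h' x) = m (b, a, x) \<otimes> m' (b, a, x)"
        unfolding m(1) m'(1) list_monomial_mult[OF l(1,2)] prod.case nat_pow_mult[OF a, symmetric]
        using closed a by (simp add: m_ac)
    qed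
  qed (rule mixed_termsI[OF refl _ _ _ pol], use m m' in \<open>auto simp: sum_list_map2_add\<close>)
next
  fix D D' :: nat assume D: "D \<le> D'"
  show "mixed_terms k n D \<subseteq> mixed_terms k n D'"
  proof
    fix m assume "m \<in> mixed_terms k n D"
    then obtain i l h where m: "m = (\<lambda>(b, a, x). a [^] (i::nat) \<otimes> list_monomial l b \<otimes> h x)" "i \<le> D"
      "length l = k" "sum_list l \<le> D" "pol n (D - sum_list l) h"
      by (rule mixed_termsE)
    show "m \<in> mixed_terms k n D'"
      by (rule mixed_termsI[OF m(1) _ m(3) _ pol_mono[OF m(5)]]) (use m D in auto)
  qed
qed

lemmas mixed_cong = graded_functions.gr_cong[OF graded_mixed]
  and mixed_term = graded_functions.gr_term[OF graded_mixed]
  and mixed_mono = graded_functions.gr_mono[OF graded_mixed]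
  and mixed_const = graded_functions.gr_const[OF graded_mixed]
  and mixed_add = graded_functions.gr_add[OF graded_mixed]
  and mixed_mult = graded_functions.gr_mult[OF graded_mixed]
  and mixed_pow = graded_functions.gr_pow[OF graded_mixed]
  and mixed_finprod = graded_functions.gr_finprod[OF graded_mixed]
  and mixed_finsum = graded_functions.gr_finsum[OF graded_mixed]
  and mixed_zero = graded_functions.gr_zero[OF graded_mixed]
  and mixed_induct [consumes 1, case_names gr_zero gr_add_term] =
    graded_functions.gr.induct[OF graded_mixed]

lemma mixed_b:
  assumes "j < k" shows "mixed k n 1 (\<lambda>(b, a, x). b j)"
proof -
  have "sum_list ((replicate k 0)[j := 1 :: nat]) = 1"
    using assms by (simp add: sum_list_update)
  then have "(\<lambda>(b, a, x). a [^] (0::nat) \<otimes> list_monomial ((replicate k 0)[j := 1]) b \<otimes> \<one>) \<in> mixed_terms k n 1"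
    by (intro mixed_termsI[OF refl] pol_const) auto
  from mixed_term[OF this] show ?thesis
  proof (rule mixed_cong)
    fix s assume "s \<in> V k \<times> carrier R \<times> V n"
    then obtain b a x where s: "s = (b, a, x)" "b \<in> V k" by blast
    show "(case s of (b, a, x) \<Rightarrow> a [^] (0::nat) \<otimes> list_monomial ((replicate k 0)[j := 1]) b \<otimes> \<one>)
        = (case s of (b, a, x) \<Rightarrow> b j)"
      unfolding s(1) prod.case list_monomial_unit[OF assms s(2)]
      using PiE_mem[OF s(2), of j] assms by simp
  qed
qed

text \<open>The product counts as degree 1, not 2, because the power of \<open>a\<close> is bounded
  separately. This makes every coordinate of the point u + sum + a x a function of mixed degree
  1.\<close>

lemma mixed_ax:
  assumes "i < n" shows "mixed k n 1 (\<lambda>(b, a, x). a \<otimes> x i)"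
proof -
  have "(\<lambda>(b, a, x). a [^] (1::nat) \<otimes> list_monomial (replicate k 0) b \<otimes> x i) \<in> mixed_terms k n 1"
    using pol_coord[OF assms] by (intro mixed_termsI[OF refl]) (auto simp: sum_list_replicate)
  from mixed_term[OF this] show ?thesis
  proof (rule mixed_cong)
    fix s assume "s \<in> V k \<times> carrier R \<times> V n"
    then obtain b a x where s: "s = (b, a, x)" "a \<in> carrier R" "x \<in> V n" by blast
    show "(case s of (b, a, x) \<Rightarrow> a [^] (1::nat) \<otimes> list_monomial (replicate k 0) b \<otimes> x i)
        = (case s of (b, a, x) \<Rightarrow> a \<otimes> x i)"
      using s(2) PiE_mem[OF s(3), of i] assms by (simp add: s(1) list_monomial_replicate)
  qed
qed

lemma mixed_substitute:
  assumes "pol n d f"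
    and \<sigma>: "\<And>s. s \<in> V k \<times> carrier R \<times> V n \<Longrightarrow> \<sigma> s \<in> V n"
    and gr: "\<And>i. i < n \<Longrightarrow> mixed k n 1 (\<lambda>s. \<sigma> s i)"
  shows "mixed k n d (\<lambda>s. f (\<sigma> s))"
  using assms(1)
proof (induction rule: pol_induct)
  case (gr_zero g)
  then show ?case using \<sigma> by (intro mixed_zero) simp
next
  case (gr_add_term m h g)
  obtain c e where m: "m = (\<lambda>x. c \<otimes> (\<Otimes>i\<in>{..<n}. x i [^] (e i :: nat)))" "c \<in> carrier R"
      and e: "(\<Sum>i<n. e i) \<le> d"
    using gr_add_term(1) unfolding mons_def by blast
  have "mixed k n (0 + (\<Sum>i<n. 1 * e i)) (\<lambda>s. m (\<sigma> s))"
    unfolding m(1) using gr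
    by (intro mixed_mult mixed_const mixed_finprod mixed_pow m(2)) auto
  then have "mixed k n d (\<lambda>s. m (\<sigma> s))" by (rule mixed_mono) (use e in simp)
  from mixed_add[OF this gr_add_term(4)] show ?case
    by (rule mixed_cong) (use gr_add_term(3) \<sigma> in simp)
qed

definition mixed_index :: "nat \<Rightarrow> nat \<Rightarrow> (nat \<times> nat list) set" where
  "mixed_index k D = {..D} \<times> {l. length l = k \<and> sum_list l \<le> D}"

lemma finite_mixed_index: "finite (mixed_index k D)"
  unfolding mixed_index_def using finite_lists_sum_le by blast

text \<open>Terms with the same exponents of \<open>a\<close> and \<open>b\<close> are merged, so
  the number of coefficient conditions is the number of indices, however long the sum was. For small
  q different indices can give the same function of \<open>a\<close> and \<open>b\<close>, so the
  \<open>h t\<close> are not unique; any choice serves.\<close>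

lemma mixed_collect:
  assumes "mixed k n D g"
  shows "\<exists>h. (\<forall>t\<in>mixed_index k D. pol n (D - sum_list (snd t)) (h t)) \<and>
    (\<forall>b\<in>V k. \<forall>a\<in>carrier R. \<forall>x\<in>V n. g (b, a, x) =
      (\<Oplus>t\<in>mixed_index k D. a [^] fst t \<otimes> list_monomial (snd t) b \<otimes> h t x))"
  using assms
proof (induction rule: mixed_induct)
  case (gr_zero g)
  show ?case
  proof (intro exI[of _ "\<lambda>_ _. \<zero>"] conjI ballI)
    fix b a x assume *: "b \<in> V k" "a \<in> carrier R" "x \<in> V n"
    have "(\<Oplus>t\<in>mixed_index k D. a [^] fst t \<otimes> list_monomial (snd t) b \<otimes> \<zero>)
        = (\<Oplus>t\<in>mixed_index k D. \<zero>)"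
      using * list_monomial_closed by (intro finsum_cong') (auto simp: mixed_index_def)
    then show "g (b, a, x) = (\<Oplus>t\<in>mixed_index k D. a [^] fst t \<otimes> list_monomial (snd t) b \<otimes> \<zero>)"
      using gr_zero * by simp
  qed (simp add: pol_const)
next
  case (gr_add_term m g' g)
  obtain i l h' where m: "m = (\<lambda>(b, a, x). a [^] (i::nat) \<otimes> list_monomial l b \<otimes> h' x)" "i \<le> D"
    "length l = k" "sum_list l \<le> D" "pol n (D - sum_list l) h'"
    using gr_add_term(1) by (rule mixed_termsE)
  obtain h where h': "\<forall>t\<in>mixed_index k D. pol n (D - sum_list (snd t)) (h t)"
    "\<forall>b\<in>V k. \<forall>a\<in>carrier R. \<forall>x\<in>V n.
      g' (b, a, x) = (\<Oplus>t\<in>mixed_index k D. a [^] fst t \<otimes> list_monomial (snd t) b \<otimes> h t x)"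
    using gr_add_term(4) by (elim exE conjE)
  note h = h'(1)[rule_format] h'(2)[rule_format]
  let ?t = "(i, l)"
  have t: "?t \<in> mixed_index k D" using m by (simp add: mixed_index_def)
  define H where "H = h(?t := \<lambda>x. h ?t x \<oplus> h' x)"
  show ?case
  proof (intro exI[of _ H] conjI ballI)
    fix u assume u: "u \<in> mixed_index k D"
    show "pol n (D - sum_list (snd u)) (H u)"
      using pol_add[OF h(1)[OF t], of h'] m(5) h(1)[OF u] by (auto simp: H_def)
  next
    fix b a x assume b: "b \<in> V k" and a: "a \<in> carrier R" and x: "x \<in> V n"
    define w where "w u = a [^] fst u \<otimes> list_monomial (snd u) b" for u :: "nat \<times> nat list"
    have w: "w u \<in> carrier R" if "u \<in> mixed_index k D" for u
    proof -
      have "length (snd u) = k" using that by (auto simp: mixed_index_def)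
      then show ?thesis using list_monomial_closed[of b "snd u"] a b by (simp add: w_def)
    qed
    have hx: "h u x \<in> carrier R" if "u \<in> mixed_index k D" for u
      using pol_closed[OF h(1)[OF that] x] .
    have h'x: "h' x \<in> carrier R" using pol_closed[OF m(5) x] .
    have "(\<Oplus>u\<in>mixed_index k D. w u \<otimes> H u x)
        = (\<Oplus>u\<in>mixed_index k D. (if ?t = u then w u \<otimes> h' x else \<zero>) \<oplus> w u \<otimes> h u x)"
      using w hx h'x by (intro finsum_cong') (auto simp: H_def r_distr a_comm)
    also have "\<dots> = (\<Oplus>u\<in>mixed_index k D. if ?t = u then w u \<otimes> h' x else \<zero>)
        \<oplus> (\<Oplus>u\<in>mixed_index k D. w u \<otimes> h u x)"
      using w hx h'x by (intro finsum_addf) auto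
    also have "(\<Oplus>u\<in>mixed_index k D. if ?t = u then w u \<otimes> h' x else \<zero>) = w ?t \<otimes> h' x"
      using w h'x t by (intro finsum_singleton finite_mixed_index) auto
    finally show "g (b, a, x) = (\<Oplus>u\<in>mixed_index k D. a [^] fst u \<otimes> list_monomial (snd u) b \<otimes> H u x)"
      using gr_add_term(3)[of "(b, a, x)"] a b x h(2)[OF b a x] m(1) by (simp add: w_def)
  qed
qed

section \<open>Extending the subspace\<close>

text \<open>The vector operations are written out by coordinates so that degrees can be computed
  coordinatewise; \<open>add_coord_space\<close>, \<open>smult_coord_space\<close> and
  \<open>zero_coord_space\<close> link them to the module operations.\<close>

definition lin_comb :: "nat \<Rightarrow> nat \<Rightarrow> (nat \<Rightarrow> nat \<Rightarrow> 'a) \<Rightarrow> (nat \<Rightarrow> 'a) \<Rightarrow> nat \<Rightarrow> 'a" where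
  "lin_comb n k v b = (\<lambda>i\<in>{..<n}. \<Oplus>j\<in>{..<k}. b j \<otimes> v j i)"

definition vec_add :: "nat \<Rightarrow> (nat \<Rightarrow> 'a) \<Rightarrow> (nat \<Rightarrow> 'a) \<Rightarrow> nat \<Rightarrow> 'a" where
  "vec_add n x y = (\<lambda>i\<in>{..<n}. x i \<oplus> y i)"

definition vec_smult :: "nat \<Rightarrow> 'a \<Rightarrow> (nat \<Rightarrow> 'a) \<Rightarrow> nat \<Rightarrow> 'a" where
  "vec_smult n a x = (\<lambda>i\<in>{..<n}. a \<otimes> x i)"

definition vec_zero :: "nat \<Rightarrow> nat \<Rightarrow> 'a" where
  "vec_zero n = (\<lambda>i\<in>{..<n}. \<zero>)"

lemma V_nth: "x \<in> V n \<Longrightarrow> i < n \<Longrightarrow> x i \<in> carrier R"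
  using PiE_mem[of x "{..<n}" "\<lambda>_. carrier R" i] by simp

lemma vec_add_closed: "x \<in> V n \<Longrightarrow> y \<in> V n \<Longrightarrow> vec_add n x y \<in> V n"
  unfolding vec_add_def restrict_PiE_iff by (simp add: V_nth)

lemma vec_smult_closed: "a \<in> carrier R \<Longrightarrow> x \<in> V n \<Longrightarrow> vec_smult n a x \<in> V n"
  unfolding vec_smult_def restrict_PiE_iff by (simp add: V_nth)

lemma vec_zero_closed: "vec_zero n \<in> V n"
  unfolding vec_zero_def restrict_PiE_iff by simp

lemma lin_comb_closed:
  assumes "\<And>j. j < k \<Longrightarrow> v j \<in> V n" "b \<in> V k"
  shows "lin_comb n k v b \<in> V n"
  unfolding lin_comb_def restrict_PiE_iff using assms V_nth by (auto intro!: finsum_closed)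

lemma linear_form_mixed:
  assumes u: "u \<in> V n" and v: "\<And>j. j < k \<Longrightarrow> v j \<in> V n" and i: "i < n"
  shows "mixed k n 1 (\<lambda>s. (case s of (b, a, x) \<Rightarrow>
    vec_add n u (vec_add n (lin_comb n k v b) (vec_smult n a x))) i)"
proof -
  have "mixed k n 1 (\<lambda>s. \<Oplus>j\<in>{..<k}. (case s of (b, a, x) \<Rightarrow> b j) \<otimes> v j i)"
  proof (rule mixed_finsum)
    fix j assume j: "j \<in> {..<k}"
    have "mixed k n (1 + 0) (\<lambda>s. (case s of (b, a, x) \<Rightarrow> b j) \<otimes> v j i)"
      using j v i V_nth by (intro mixed_mult mixed_const mixed_b) auto
    then show "mixed k n 1 (\<lambda>s. (case s of (b, a, x) \<Rightarrow> b j) \<otimes> v j i)" by simp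
  qed simp
  then have "mixed k n 1 (\<lambda>s. u i \<oplus> ((\<Oplus>j\<in>{..<k}. (case s of (b, a, x) \<Rightarrow> b j) \<otimes> v j i) \<oplus>
      (case s of (b, a, x) \<Rightarrow> a \<otimes> x i)))"
    by (intro mixed_add mixed_const mixed_ax i V_nth[OF u i])
  then show ?thesis
    by (rule mixed_cong) (use i in \<open>simp add: vec_add_def vec_smult_def lin_comb_def split: prod.split\<close>)
qed

lemma extension_vector:
  assumes f: "pol n d f" and d: "1 \<le> d" and u: "u \<in> V n" and v': "\<forall>j<k. v j \<in> V n"
    and P: "P \<subseteq> {..<n}" "card P = k"
    and n: "k + (d + 1) * (\<Sum>j=0..d - 1. (d - j) * ((k + j - 1) choose j)) < n"
  shows "\<exists>x\<in>V n. x \<noteq> vec_zero n \<and> (\<forall>p\<in>P. x p = \<zero>) \<and>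
    (\<forall>b\<in>V k. \<forall>a\<in>carrier R.
      f (vec_add n u (vec_add n (lin_comb n k v b) (vec_smult n a x))) = f (vec_add n u (lin_comb n k v b)))"
proof -
  note v = v'[rule_format]
  define \<sigma> where "\<sigma> s = (case s of (b, a, x) \<Rightarrow>
    vec_add n u (vec_add n (lin_comb n k v b) (vec_smult n a x)))" for s
  have "mixed k n d (\<lambda>s. f (\<sigma> s))"
  proof (rule mixed_substitute[OF f])
    show "\<sigma> s \<in> V n" if "s \<in> V k \<times> carrier R \<times> V n" for s
      using that u v
      by (auto simp: \<sigma>_def simp del: PiE_iff intro!: vec_add_closed vec_smult_closed lin_comb_closed)
    show "mixed k n 1 (\<lambda>s. \<sigma> s i)" if "i < n" for i
      unfolding \<sigma>_def by (rule linear_form_mixed[OF u v that])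
  qed
  from mixed_collect[OF this] obtain h where
    h': "\<forall>t\<in>mixed_index k d. pol n (d - sum_list (snd t)) (h t)"
    "\<forall>b\<in>V k. \<forall>a\<in>carrier R. \<forall>x\<in>V n. f (\<sigma> (b, a, x)) =
      (\<Oplus>t\<in>mixed_index k d. a [^] fst t \<otimes> list_monomial (snd t) b \<otimes> h t x)" by (elim exE conjE)
  note h = h'(1)[rule_format] h'(2)[rule_format]
  define z where "z = vec_zero n"
  have z: "z \<in> V n" unfolding z_def by (rule vec_zero_closed)
  have finP: "finite P" using P finite_subset by blast
  \<comment> \<open>Left elements index the coefficient conditions, normalised to vanish at
    \<open>z = 0\<close>; right elements index the equations \<open>x p = 0\<close>. So
    \<open>z\<close> is a common zero, and any other common zero is a nonzero vector.\<close>
  define T where "T = mixed_index k d <+> P"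
  define Q where "Q t = (case t of Inl s \<Rightarrow> (\<lambda>x. h s x \<ominus> h s z) | Inr p \<Rightarrow> (\<lambda>x. x p))" for t
  define D where "D t = (case t of Inl s \<Rightarrow> d - sum_list (snd s) | Inr p \<Rightarrow> 1)"
    for t :: "(nat \<times> nat list) + nat"
  have "\<exists>x\<in>V n. x \<noteq> z \<and> (\<forall>t\<in>T. Q t x = \<zero>)"
  proof (rule chevalley_warning[where D = D])
    show "finite T" unfolding T_def using finite_mixed_index finP by (intro finite_Plus)
    show "pol n (D t) (Q t)" if "t \<in> T" for t
    proof (cases t)
      case (Inl s)
      then have s: "s \<in> mixed_index k d" using that by (auto simp: T_def)
      then show ?thesis
        unfolding Inl Q_def D_def sum.case by (intro pol_minus_const h(1) pol_closed[OF h(1) z])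
    next
      case (Inr p)
      then have "p < n" using that P by (auto simp: T_def)
      then show ?thesis unfolding Inr Q_def D_def sum.case by (rule pol_coord)
    qed
    show "Q t z = \<zero>" if "t \<in> T" for t
    proof (cases t)
      case (Inl s)
      then have s: "s \<in> mixed_index k d" using that by (auto simp: T_def)
      then show ?thesis
        unfolding Inl Q_def sum.case using pol_closed[OF h(1) z, of s] by (simp add: r_right_minus_eq)
    next
      case (Inr p)
      then have "p < n" using that P by (auto simp: T_def)
      then show ?thesis unfolding Inr Q_def sum.case by (simp add: z_def vec_zero_def)
    qed
    have "(\<Sum>t\<in>T. D t) = (\<Sum>s\<in>mixed_index k d. d - sum_list (snd s)) + (\<Sum>p\<in>P. 1)"
      unfolding T_def D_def using finite_mixed_index finP by (subst sum.Plus) auto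
    \<comment> \<open>The degree does not involve the exponent of \<open>a\<close>, so its
      \<open>d + 1\<close> values repeat one and the same sum.\<close>
    also have "(\<Sum>s\<in>mixed_index k d. d - sum_list (snd s))
        = (\<Sum>i\<le>d. \<Sum>l | length l = k \<and> sum_list l \<le> d. d - sum_list l)"
      unfolding mixed_index_def by (subst sum.cartesian_product) (simp add: case_prod_beta)
    also have "\<dots> = (d + 1) * (\<Sum>j=0..d - 1. (d - j) * ((k + j - 1) choose j))"
      unfolding sum_over_exponent_lists[OF d] by simp
    finally show "(\<Sum>t\<in>T. D t) < n" using n P(2) by simp
  qed (rule z)
  then obtain x where x: "x \<in> V n" "x \<noteq> z" "\<And>t. t \<in> T \<Longrightarrow> Q t x = \<zero>" by metis
  have hx: "h s x = h s z" if s: "s \<in> mixed_index k d" for s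
  proof -
    have "Inl s \<in> T" using s by (auto simp: T_def)
    from x(3)[OF this] show ?thesis
      using pol_closed[OF h(1)[OF s] z] pol_closed[OF h(1)[OF s] x(1)] by (simp add: Q_def)
  qed
  have xp: "x p = \<zero>" if "p \<in> P" for p
  proof -
    have "Inr p \<in> T" using that by (auto simp: T_def)
    from x(3)[OF this] show ?thesis by (simp add: Q_def)
  qed
  have fx: "f (\<sigma> (b, a, x)) = f (vec_add n u (lin_comb n k v b))" if b: "b \<in> V k" and a: "a \<in> carrier R" for b a
  proof -
    have "f (\<sigma> (b, a, x)) = (\<Oplus>t\<in>mixed_index k d. a [^] fst t \<otimes> list_monomial (snd t) b \<otimes> h t x)"
      by (rule h(2)[OF b a x(1)])
    also have "\<dots> = (\<Oplus>t\<in>mixed_index k d. a [^] fst t \<otimes> list_monomial (snd t) b \<otimes> h t z)"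
    proof (rule finsum_cong')
      show "(\<lambda>t. a [^] fst t \<otimes> list_monomial (snd t) b \<otimes> h t z) \<in> mixed_index k d \<rightarrow> carrier R"
      proof
        fix t assume t: "t \<in> mixed_index k d"
        then have "length (snd t) = k" by (auto simp: mixed_index_def)
        then have "list_monomial (snd t) b \<in> carrier R" using list_monomial_closed b by blast
        then show "a [^] fst t \<otimes> list_monomial (snd t) b \<otimes> h t z \<in> carrier R"
          by (intro m_closed nat_pow_closed a pol_closed[OF h(1)[OF t] z])
      qed
    qed (use hx in simp_all)
    \<comment> \<open>The same expansion is read backwards at \<open>z = 0\<close>, where the
      multiple of the new vector disappears and a point of u + U remains.\<close>
    also have "\<dots> = f (\<sigma> (b, a, z))" by (rule h(2)[OF b a z, symmetric])
    also have "\<sigma> (b, a, z) = vec_add n u (lin_comb n k v b)"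
    proof -
      have "lin_comb n k v b \<in> V n" by (rule lin_comb_closed[OF v b])
      then have "vec_add n (lin_comb n k v b) (vec_smult n a z) i = lin_comb n k v b i" for i
        using V_nth[of "lin_comb n k v b" n i] PiE_arb[of "lin_comb n k v b" "{..<n}" _ i] a
        by (cases "i < n") (auto simp: vec_add_def vec_smult_def z_def vec_zero_def simp del: PiE_iff)
      then show ?thesis unfolding \<sigma>_def prod.case by presburger
    qed
    finally show ?thesis .
  qed
  show ?thesis
    using x(1,2) xp fx unfolding \<sigma>_def z_def prod.case by blast
qed

lemma lin_comb_Suc:
  assumes v: "\<And>j. j < k \<Longrightarrow> v j \<in> V n" and x: "x \<in> V n" and b: "b \<in> V (Suc k)"
  shows "lin_comb n (Suc k) (v(k := x)) b
    = vec_add n (lin_comb n k v (restrict b {..<k})) (vec_smult n (b k) x)"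
proof
  fix i
  show "lin_comb n (Suc k) (v(k := x)) b i
    = vec_add n (lin_comb n k v (restrict b {..<k})) (vec_smult n (b k) x) i"
  proof (cases "i < n")
    case True
    have bj: "b j \<in> carrier R" if "j < Suc k" for j using V_nth[OF b that] .
    have vj: "v j i \<in> carrier R" if "j < k" for j using V_nth[OF v[OF that] True] .
    have xi: "x i \<in> carrier R" using V_nth[OF x True] .
    have "(\<Oplus>j\<in>{..<Suc k}. b j \<otimes> (v(k := x)) j i)
        = b k \<otimes> x i \<oplus> (\<Oplus>j\<in>{..<k}. b j \<otimes> (v(k := x)) j i)"
      unfolding lessThan_Suc using bj vj xi by (subst finsum_insert) auto
    also have "(\<Oplus>j\<in>{..<k}. b j \<otimes> (v(k := x)) j i) = (\<Oplus>j\<in>{..<k}. restrict b {..<k} j \<otimes> v j i)"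
      using bj vj by (intro finsum_cong') auto
    also have "b k \<otimes> x i \<oplus> (\<Oplus>j\<in>{..<k}. restrict b {..<k} j \<otimes> v j i)
        = (\<Oplus>j\<in>{..<k}. restrict b {..<k} j \<otimes> v j i) \<oplus> b k \<otimes> x i"
      using bj vj xi by (intro a_comm finsum_closed) auto
    finally show ?thesis using True by (simp add: lin_comb_def vec_add_def vec_smult_def)
  qed (simp add: lin_comb_def vec_add_def)
qed

lemma lin_comb_0: "lin_comb n 0 v b = vec_zero n"
  by (simp add: lin_comb_def vec_zero_def)

lemma vec_add_zero: "x \<in> V n \<Longrightarrow> vec_add n x (vec_zero n) = x"
  using V_nth[of x n] PiE_arb[of x "{..<n}"]
  by (intro ext) (simp add: vec_add_def vec_zero_def)

text \<open>The coordinate set \<open>P\<close> witnesses the linear independence of the chosen vectors and, when the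
  next vector is required to vanish on it, keeps that vector outside their span.\<close>

lemma constant_on_lin_combs:
  assumes f: "pol n d f" and d: "1 \<le> d" and u: "u \<in> V n" and k: "k \<le> guaranteed_dim n d"
  shows "\<exists>v P. (\<forall>j<k. v j \<in> V n) \<and> P \<subseteq> {..<n} \<and> card P = k \<and>
    (\<forall>b\<in>V k. (\<forall>p\<in>P. lin_comb n k v b p = \<zero>) \<longrightarrow> (\<forall>j<k. b j = \<zero>)) \<and>
    (\<forall>b\<in>V k. f (vec_add n u (lin_comb n k v b)) = f u)"
  using k
proof (induction k)
  case 0
  show ?case
    by (intro exI[of _ "\<lambda>_ _. \<zero>"] exI[of _ "{}"]) (simp add: lin_comb_0 vec_add_zero[OF u])
next
  case (Suc k)
  obtain v P where v': "\<forall>j<k. v j \<in> V n" and P: "P \<subseteq> {..<n}" "card P = k"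
    and indep: "\<forall>b\<in>V k. (\<forall>p\<in>P. lin_comb n k v b p = \<zero>) \<longrightarrow> (\<forall>j<k. b j = \<zero>)"
    and const: "\<forall>b\<in>V k. f (vec_add n u (lin_comb n k v b)) = f u"
    using Suc.IH[OF Suc_leD[OF Suc.prems]] by (elim exE conjE)
  note v = v'[rule_format]
  obtain x where x: "x \<in> V n" "x \<noteq> vec_zero n" "\<forall>p\<in>P. x p = \<zero>"
    and fx: "\<forall>b\<in>V k. \<forall>a\<in>carrier R.
      f (vec_add n u (vec_add n (lin_comb n k v b) (vec_smult n a x))) = f (vec_add n u (lin_comb n k v b))"
    using extension_vector[OF f d u v' P guaranteed_dim_less[OF Suc_le_lessD[OF Suc.prems]]]
    by (elim bexE conjE)
  \<comment> \<open>A nonzero coordinate of \<open>x\<close> becomes the new pivot; since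
    \<open>x\<close> vanishes on \<open>P\<close>, it is not an old one.\<close>
  obtain p where p: "p < n" "x p \<noteq> \<zero>"
  proof -
    have "\<exists>p<n. x p \<noteq> \<zero>"
    proof (rule ccontr)
      assume *: "\<not> (\<exists>p<n. x p \<noteq> \<zero>)"
      have "x i = vec_zero n i" for i
        using * PiE_arb[OF x(1), of i] by (cases "i < n") (auto simp: vec_zero_def)
      then show False using x(2) by blast
    qed
    then show ?thesis using that by blast
  qed
  have pP: "p \<notin> P" using p x(3) by blast
  have finP: "finite P" using P finite_subset by blast
  have restr: "restrict b {..<k} \<in> V k" and bk: "b k \<in> carrier R" if b: "b \<in> V (Suc k)" for b
    unfolding restrict_PiE_iff using V_nth[OF b] by simp_all
  have v_Suc: "(v(k := x)) j \<in> V n" if "j < Suc k" for j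
    using v[of j] x(1) that by (cases "j = k") simp_all
  have P_Suc: "insert p P \<subseteq> {..<n}" "card (insert p P) = Suc k" using p P pP finP by auto
  have indep_Suc: "b j = \<zero>" if b: "b \<in> V (Suc k)"
      and zero: "\<forall>p\<in>insert p P. lin_comb n (Suc k) (v(k := x)) b p = \<zero>" and j: "j < Suc k" for b j
  proof -
    define w where "w = lin_comb n k v (restrict b {..<k})"
    have lc: "lin_comb n (Suc k) (v(k := x)) b = vec_add n w (vec_smult n (b k) x)"
      unfolding w_def by (rule lin_comb_Suc[OF v x(1) b])
    have w: "w \<in> V n" unfolding w_def by (rule lin_comb_closed[OF v restr[OF b]])
    have eq: "w i \<oplus> b k \<otimes> x i = \<zero>" if "i \<in> insert p P" for i
    proof -
      have "i < n" using that p P by auto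
      then show ?thesis
        using bspec[OF zero that] unfolding lc by (simp add: vec_add_def vec_smult_def)
    qed
    \<comment> \<open>The system is triangular: on the old pivots \<open>x\<close> contributes
      nothing, so the first \<open>k\<close> coefficients vanish. Then \<open>w\<close> is zero at
      \<open>p\<close>, and the new pivot isolates \<open>b k \<otimes> x p\<close>.\<close>
    have "w i = \<zero>" if "i \<in> P" for i
    proof -
      have "i < n" using that P by auto
      then show ?thesis using eq[of i] that x(3) bk[OF b] V_nth[OF w] by simp
    qed
    then have b0: "\<forall>j<k. restrict b {..<k} j = \<zero>" using indep restr[OF b] w_def by blast
    have "w p = (\<Oplus>j\<in>{..<k}. restrict b {..<k} j \<otimes> v j p)"
      unfolding w_def lin_comb_def using p by simp
    also have "\<dots> = (\<Oplus>j\<in>{..<k}. \<zero>)"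
      using b0 V_nth[OF v p(1)] by (intro finsum_cong') auto
    finally have "w p = \<zero>" by simp
    then have "b k \<otimes> x p = \<zero>" using eq[of p] bk[OF b] V_nth[OF x(1) p(1)] by simp
    then have "b k = \<zero>" using integral[of "b k" "x p"] bk[OF b] V_nth[OF x(1) p(1)] p by blast
    then show ?thesis using b0 j by (cases "j = k") auto
  qed
  have const_Suc: "f (vec_add n u (lin_comb n (Suc k) (v(k := x)) b)) = f u" if b: "b \<in> V (Suc k)" for b
    using fx[rule_format, OF restr[OF b] bk[OF b]] const[rule_format, OF restr[OF b]]
      lin_comb_Suc[of k v n, OF v x(1) b] by simp
  show ?case
  proof (intro exI[of _ "v(k := x)"] exI[of _ "insert p P"] conjI P_Suc)
    show "\<forall>j<Suc k. (v(k := x)) j \<in> V n"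
      by (intro allI impI, rule v_Suc)
    show "\<forall>b\<in>V (Suc k). (\<forall>p\<in>insert p P. lin_comb n (Suc k) (v(k := x)) b p = \<zero>) \<longrightarrow>
        (\<forall>j<Suc k. b j = \<zero>)"
      by (intro allI ballI impI, rule indep_Suc)
    show "\<forall>b\<in>V (Suc k). f (vec_add n u (lin_comb n (Suc k) (v(k := x)) b)) = f u"
      by (intro ballI, rule const_Suc)
  qed
qed

section \<open>Subspaces of the coordinate space and their dimension\<close>

lemma vectorspace_coord_space: "vectorspace R (coord_space R n)"
proof -
  have "module R (coord_space R n)" by (rule func_space_is_module)
  then show ?thesis using field_axioms by (simp add: vectorspace_def)
qed

lemma add_coord_space: "x \<oplus>\<^bsub>coord_space R n\<^esub> y = vec_add n x y"
  by (simp add: func_space_def vec_add_def)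

lemma smult_coord_space: "a \<odot>\<^bsub>coord_space R n\<^esub> x = vec_smult n a x"
  by (simp add: func_space_def vec_smult_def)

lemma zero_coord_space: "\<zero>\<^bsub>coord_space R n\<^esub> = vec_zero n"
  by (simp add: func_space_def vec_zero_def)

lemma card_subspace:
  assumes "subspace R U (coord_space R n)"
  shows "card U = q ^ vectorspace.dim R ((coord_space R n)\<lparr>carrier := U\<rparr>)"
proof -
  interpret vectorspace R "coord_space R n" by (rule vectorspace_coord_space)
  interpret U: vectorspace R "(coord_space R n)\<lparr>carrier := U\<rparr>" by (rule subspace_is_vs[OF assms])
  have "U \<subseteq> V n" using submodule.subset[OF is_module[OF assms]] by (simp add: carrier_coord_space)
  then have "finite U" by (rule finite_subset[OF _ finite_V])
  then show ?thesis using U.card_carrier_eq_power_dim by simp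
qed

text \<open>A subspace of dimension \<open>k\<close> has \<open>q^k\<close> of the
  \<open>q^n\<close> points. This bounds the dimensions over which \<open>max_const_dim\<close>
  maximises.\<close>

lemma linear_subspace_of_dim_le:
  assumes "linear_subspace_of_dim R n k U"
  shows "k \<le> n"
proof -
  interpret vectorspace R "coord_space R n" by (rule vectorspace_coord_space)
  have U: "subspace R U (coord_space R n)" "vectorspace.dim R ((coord_space R n)\<lparr>carrier := U\<rparr>) = k"
    using assms by (auto simp: linear_subspace_of_dim_def)
  have "U \<subseteq> V n" using submodule.subset[OF is_module[OF U(1)]] by (simp add: carrier_coord_space)
  then have "q ^ k \<le> q ^ n" using card_subspace[OF U(1)] U(2) card_mono[OF finite_V] card_V by metis
  then show ?thesis using q_gt_1 by simp
qed

lemma lin_comb_add: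
  assumes v': "\<forall>j<k. v j \<in> V n" and b: "b \<in> V k" "b' \<in> V k"
  shows "vec_add n (lin_comb n k v b) (lin_comb n k v b') = lin_comb n k v (vec_add k b b')"
proof
  note v = v'[rule_format]
  fix i
  show "vec_add n (lin_comb n k v b) (lin_comb n k v b') i = lin_comb n k v (vec_add k b b') i"
  proof (cases "i < n")
    case True
    have c: "b j \<in> carrier R" "b' j \<in> carrier R" "v j i \<in> carrier R" if "j < k" for j
      using V_nth[OF b(1) that] V_nth[OF b(2) that] V_nth[OF v[OF that] True] by simp_all
    have "(\<Oplus>j\<in>{..<k}. b j \<otimes> v j i) \<oplus> (\<Oplus>j\<in>{..<k}. b' j \<otimes> v j i)
        = (\<Oplus>j\<in>{..<k}. b j \<otimes> v j i \<oplus> b' j \<otimes> v j i)"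
      using c by (intro finsum_addf[symmetric]) auto
    also have "\<dots> = (\<Oplus>j\<in>{..<k}. vec_add k b b' j \<otimes> v j i)"
      using c by (intro finsum_cong') (auto simp: vec_add_def l_distr)
    finally show ?thesis using True by (simp add: lin_comb_def vec_add_def)
  qed (simp add: lin_comb_def vec_add_def)
qed

lemma lin_comb_smult:
  assumes v': "\<forall>j<k. v j \<in> V n" and b: "b \<in> V k" and a: "a \<in> carrier R"
  shows "vec_smult n a (lin_comb n k v b) = lin_comb n k v (vec_smult k a b)"
proof
  note v = v'[rule_format]
  fix i
  show "vec_smult n a (lin_comb n k v b) i = lin_comb n k v (vec_smult k a b) i"
  proof (cases "i < n")
    case True
    have c: "b j \<in> carrier R" "v j i \<in> carrier R" if "j < k" for j
      using V_nth[OF b that] V_nth[OF v[OF that] True] by simp_all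
    have "a \<otimes> (\<Oplus>j\<in>{..<k}. b j \<otimes> v j i) = (\<Oplus>j\<in>{..<k}. a \<otimes> (b j \<otimes> v j i))"
      using c a by (intro finsum_rdistr) auto
    also have "\<dots> = (\<Oplus>j\<in>{..<k}. vec_smult k a b j \<otimes> v j i)"
      using c a by (intro finsum_cong') (auto simp: vec_smult_def m_assoc)
    finally show ?thesis using True by (simp add: lin_comb_def vec_smult_def)
  qed (simp add: lin_comb_def vec_smult_def)
qed

text \<open>Independence makes the map from coefficients to vectors injective, so the image has
  \<open>q^k\<close> points. It also has q to the power of its dimension many, and
  \<open>q > 1\<close> lets the exponents be compared.\<close>

lemma linear_subspace_lin_combs:
  assumes v': "\<forall>j<k. v j \<in> V n"
    and indep: "\<And>b j. b \<in> V k \<Longrightarrow> lin_comb n k v b = vec_zero n \<Longrightarrow> j < k \<Longrightarrow> b j = \<zero>"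
  shows "linear_subspace_of_dim R n k (lin_comb n k v ` V k)"
proof -
  note v = v'[rule_format]
  let ?U = "lin_comb n k v ` V k"
  have "lin_comb n k v (vec_zero k) i = vec_zero n i" for i
  proof (cases "i < n")
    case True
    have "(\<Oplus>j\<in>{..<k}. vec_zero k j \<otimes> v j i) = (\<Oplus>j\<in>{..<k}. \<zero>)"
      using V_nth[OF v True] by (intro finsum_cong') (auto simp: vec_zero_def)
    then show ?thesis using True by (simp add: lin_comb_def vec_zero_def)
  qed (simp add: lin_comb_def vec_zero_def)
  then have zero: "lin_comb n k v (vec_zero k) = vec_zero n" by (rule ext)
  have sub: "subspace R ?U (coord_space R n)"
  proof (rule subspace.intro[OF vectorspace_coord_space], rule submodule.intro[OF func_space_is_module])
    show "?U \<subseteq> carrier (coord_space R n)"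
      unfolding carrier_coord_space by (rule image_subsetI, rule lin_comb_closed[OF v])
    show "\<zero>\<^bsub>coord_space R n\<^esub> \<in> ?U"
      unfolding zero_coord_space zero[symmetric] using vec_zero_closed by (rule imageI)
    show "x \<oplus>\<^bsub>coord_space R n\<^esub> y \<in> ?U" if xy: "x \<in> ?U" "y \<in> ?U" for x y
    proof -
      obtain b b' where b: "b \<in> V k" "b' \<in> V k" "x = lin_comb n k v b" "y = lin_comb n k v b'"
        using xy by (elim imageE)
      show ?thesis
        unfolding add_coord_space b(3,4) lin_comb_add[OF v' b(1,2)]
        by (intro imageI vec_add_closed b)
    qed
    show "a \<odot>\<^bsub>coord_space R n\<^esub> x \<in> ?U" if a: "a \<in> carrier R" and x: "x \<in> ?U" for a x
    proof -
      obtain b where b: "b \<in> V k" "x = lin_comb n k v b" using x by (elim imageE)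
      show ?thesis
        unfolding smult_coord_space b(2) lin_comb_smult[OF v' b(1) a]
        by (intro imageI vec_smult_closed a b)
    qed
  qed
  have "inj_on (lin_comb n k v) (V k)"
  proof (rule inj_onI)
    fix b b' assume b: "b \<in> V k" and b': "b' \<in> V k" and eq: "lin_comb n k v b = lin_comb n k v b'"
    define c where "c = vec_add k b (vec_smult k (\<ominus> \<one>) b')"
    have m: "vec_smult k (\<ominus> \<one>) b' \<in> V k" using b' by (intro vec_smult_closed) auto
    have "lin_comb n k v c = vec_add n (lin_comb n k v b) (vec_smult n (\<ominus> \<one>) (lin_comb n k v b'))"
      unfolding c_def using lin_comb_add[OF v' b m] lin_comb_smult[OF v' b', of "\<ominus> \<one>"] by simp
    also have "\<dots> = vec_zero n"
      unfolding eq using V_nth[OF lin_comb_closed[of k v, OF v b']]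
      by (auto simp: vec_add_def vec_smult_def vec_zero_def l_minus r_neg)
    finally have c0: "c j = \<zero>" if "j < k" for j
      using indep[of c j] vec_add_closed[OF b m] that by (simp add: c_def)
    show "b = b'"
    proof (rule PiE_ext[OF b b'])
      fix j assume "j \<in> {..<k}"
      then show "b j = b' j"
        using c0[of j] V_nth[OF b, of j] V_nth[OF b', of j]
        by (simp add: c_def vec_add_def vec_smult_def l_minus minus_eq[symmetric])
    qed
  qed
  then have "card ?U = q ^ k" by (simp add: card_image card_V)
  then have "q ^ vectorspace.dim R ((coord_space R n)\<lparr>carrier := ?U\<rparr>) = q ^ k"
    using card_subspace[OF sub] by simp
  then show ?thesis
    unfolding linear_subspace_of_dim_def using sub q_gt_1 by simp
qed

theorem constant_subspace_exists:
  assumes f: "pol n d f" and d: "1 \<le> d" and u: "u \<in> V n"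
  shows "\<exists>U. linear_subspace_of_dim R n (guaranteed_dim n d) U \<and> constant_on_translate R n f u U"
proof -
  define k where "k = guaranteed_dim n d"
  have k: "k \<le> guaranteed_dim n d" by (simp add: k_def)
  obtain v P where v: "\<forall>j<k. v j \<in> V n" and P: "P \<subseteq> {..<n}" and "card P = k"
    and indep: "\<forall>b\<in>V k. (\<forall>p\<in>P. lin_comb n k v b p = \<zero>) \<longrightarrow> (\<forall>j<k. b j = \<zero>)"
    and const: "\<forall>b\<in>V k. f (vec_add n u (lin_comb n k v b)) = f u"
    using constant_on_lin_combs[OF f d u k] by (elim exE conjE)
  have "linear_subspace_of_dim R n k (lin_comb n k v ` V k)"
  proof (rule linear_subspace_lin_combs[OF v])
    fix b j assume b: "b \<in> V k" and 0: "lin_comb n k v b = vec_zero n" and j: "j < k"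
    \<comment> \<open>A combination that is zero everywhere is in particular zero on the pivots, so
      independence as seen on \<open>P\<close> implies linear independence.\<close>
    have "\<forall>p\<in>P. lin_comb n k v b p = \<zero>" unfolding 0 using P by (auto simp: vec_zero_def)
    then show "b j = \<zero>" using indep b j by blast
  qed
  moreover have "constant_on_translate R n f u (lin_comb n k v ` V k)"
    unfolding constant_on_translate_def a_l_coset_def' add_coord_space
    using const by (intro exI[of _ "f u"]) auto
  ultimately show ?thesis unfolding k_def by (intro exI conjI)
qed

text \<open>\<open>GREATEST\<close> is informative only when the admissible dimensions are bounded.
  The zero function has degree 0 and thus qualifies for every \<open>d\<close>; applying the
  condition to it shows that they are at most \<open>n\<close>.\<close>

lemma guaranteed_dim_le_max_const_dim:
  assumes d: "1 \<le> d"
  shows "guaranteed_dim n d \<le> max_const_dim R n d"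
  unfolding max_const_dim_def
proof (rule Greatest_le_nat)
  show "\<forall>f\<in>carrier (coord_space R n) \<rightarrow> carrier R. fun_degree R n f \<le> d \<longrightarrow>
    (\<exists>u\<in>carrier (coord_space R n). \<exists>U. linear_subspace_of_dim R n (guaranteed_dim n d) U \<and>
      constant_on_translate R n f u U)"
  proof (intro ballI impI)
    fix f assume "f \<in> carrier (coord_space R n) \<rightarrow> carrier R" and deg: "fun_degree R n f \<le> d"
    then have "f \<in> V n \<rightarrow> carrier R" unfolding carrier_coord_space by simp
    then have "pol n d f" using pol_mono[OF pol_fun_degree deg] by simp
    then show "\<exists>u\<in>carrier (coord_space R n). \<exists>U. linear_subspace_of_dim R n (guaranteed_dim n d) U \<and>
        constant_on_translate R n f u U"
      unfolding carrier_coord_space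
      by (intro bexI[of _ "vec_zero n"] constant_subspace_exists d vec_zero_closed)
  qed
next
  fix k assume *: "\<forall>f\<in>carrier (coord_space R n) \<rightarrow> carrier R. fun_degree R n f \<le> d \<longrightarrow>
    (\<exists>u\<in>carrier (coord_space R n). \<exists>U. linear_subspace_of_dim R n k U \<and> constant_on_translate R n f u U)"
  have "(\<lambda>_. \<zero>) \<in> carrier (coord_space R n) \<rightarrow> carrier R" by simp
  from bspec[OF * this] obtain U where "linear_subspace_of_dim R n k U"
    unfolding fun_degree_zero by blast
  then show "k \<le> n" by (rule linear_subspace_of_dim_le)
qed

end

theorem theorem1:
  shows
    "(\<forall>(F :: 'a ring) (n :: nat) (d :: nat) (f :: (nat \<Rightarrow> 'a) \<Rightarrow> 'a) (u\<^sub>0 :: nat \<Rightarrow> 'a).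
        field F \<and> finite (carrier F) \<and> 1 \<le> n \<and> 1 \<le> d \<and>
        f \<in> carrier (coord_space F n) \<rightarrow> carrier F \<and> fun_degree F n f = d \<and>
        u\<^sub>0 \<in> carrier (coord_space F n) \<longrightarrow>
        (\<exists>U. linear_subspace_of_dim F n (guaranteed_dim n d) U \<and>
             constant_on_translate F n f u\<^sub>0 U))
     \<and> (\<exists>c\<^sub>0 :: real. 0 < c\<^sub>0 \<and> c\<^sub>0 < 1 \<and>
          (\<forall>(F :: nat ring) (n :: nat) (d :: nat).
             field F \<and> finite (carrier F) \<and> 1 \<le> n \<and> 2 \<le> d \<and>
             (d * (d + 1) < n \<or> max_const_dim F n d \<noteq> 0) \<longrightarrow>
             real (max_const_dim F n d) \<ge> c\<^sub>0 * real n powr (1 / (real d - 1))))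
     \<and> (\<exists>c :: real. 0 < c \<and>
          (\<forall>(F :: nat ring) (n :: nat) (d :: nat).
             field F \<and> finite (carrier F) \<and> 1 \<le> n \<and> 2 \<le> d \<and>
             real d \<le> log 2 (real n) / 10 \<longrightarrow>
             real (max_const_dim F n d) \<ge> c * real d * real n powr (1 / (real d - 1))))"
proof (intro conjI)
  show "\<forall>(F :: 'a ring) (n :: nat) (d :: nat) (f :: (nat \<Rightarrow> 'a) \<Rightarrow> 'a) (u\<^sub>0 :: nat \<Rightarrow> 'a).
        field F \<and> finite (carrier F) \<and> 1 \<le> n \<and> 1 \<le> d \<and>
        f \<in> carrier (coord_space F n) \<rightarrow> carrier F \<and> fun_degree F n f = d \<and>
        u\<^sub>0 \<in> carrier (coord_space F n) \<longrightarrow>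
        (\<exists>U. linear_subspace_of_dim F n (guaranteed_dim n d) U \<and>
             constant_on_translate F n f u\<^sub>0 U)"
  proof (intro allI impI, elim conjE)
    fix F :: "'a ring" and n d f u\<^sub>0
    assume F: "field F" "finite (carrier F)"
    have FF: "finite_field F" by (intro finite_field.intro finite_field_axioms.intro F)
    assume "1 \<le> d" "f \<in> carrier (coord_space F n) \<rightarrow> carrier F" "fun_degree F n f = d"
      "u\<^sub>0 \<in> carrier (coord_space F n)"
    then show "\<exists>U. linear_subspace_of_dim F n (guaranteed_dim n d) U \<and> constant_on_translate F n f u\<^sub>0 U"
      unfolding finite_field.carrier_coord_space[OF FF]
      using finite_field.constant_subspace_exists[OF FF] finite_field.pol_fun_degree[OF FF] by blast
  qed
  have le: "guaranteed_dim n d \<le> max_const_dim F n d"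
    if "field F" "finite (carrier F)" "2 \<le> d" for F :: "nat ring" and n d
    using that by (intro finite_field.guaranteed_dim_le_max_const_dim finite_field.intro
      finite_field_axioms.intro) auto
  show "\<exists>c\<^sub>0 :: real. 0 < c\<^sub>0 \<and> c\<^sub>0 < 1 \<and>
          (\<forall>(F :: nat ring) (n :: nat) (d :: nat).
             field F \<and> finite (carrier F) \<and> 1 \<le> n \<and> 2 \<le> d \<and>
             (d * (d + 1) < n \<or> max_const_dim F n d \<noteq> 0) \<longrightarrow>
             real (max_const_dim F n d) \<ge> c\<^sub>0 * real n powr (1 / (real d - 1)))"
  proof (intro exI[of _ "1 / 12"] conjI allI impI; (elim conjE)?)
    fix F :: "nat ring" and n d
    assume F: "field F" "finite (carrier F)" and d: "2 \<le> d"
      and *: "d * (d + 1) < n \<or> max_const_dim F n d \<noteq> 0"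
    \<comment> \<open>Positivity turns the bound \<open>4 * k + 8\<close> on the root into
      \<open>12 * k\<close>, hence the constant 1/12. Without \<open>*\<close> the dimension can be
      0 while the root is 1: take \<open>n = 1\<close> and the identity function.\<close>
    have "max_const_dim F n d \<ge> 1"
      using * le[OF F d, of n] guaranteed_dim_pos[of d n] d by linarith
    then show "real (max_const_dim F n d) \<ge> 1 / 12 * real n powr (1 / (real d - 1))"
      using root_le_guaranteed_dim[OF d, of n] le[OF F d, of n] by linarith
  qed simp_all
  show "\<exists>c :: real. 0 < c \<and>
          (\<forall>(F :: nat ring) (n :: nat) (d :: nat).
             field F \<and> finite (carrier F) \<and> 1 \<le> n \<and> 2 \<le> d \<and>
             real d \<le> log 2 (real n) / 10 \<longrightarrow>
             real (max_const_dim F n d) \<ge> c * real d * real n powr (1 / (real d - 1)))"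
  proof (intro exI[of _ "1 / 48"] conjI allI impI; (elim conjE)?)
    fix F :: "nat ring" and n d :: nat
    assume F: "field F" "finite (carrier F)" and n: "1 \<le> n" and d: "2 \<le> d"
      and log: "real d \<le> log 2 (real n) / 10"
    show "real (max_const_dim F n d) \<ge> 1 / 48 * real d * real n powr (1 / (real d - 1))"
      using d_root_le_guaranteed_dim[OF n d log] le[OF F d, of n] by linarith
  qed simp
qed

end
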